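(* Let $(\mathbf{x},B)$ be a labeled seed of a cluster algebra $\mathcal{A}=\mathcal{A}(\mathbf{x},B)$ of rank $n$. Then there are exact sequences of groups \[ 1\rightarrow H(\mathbf{x})\rightarrow G(B)\xrightarrow{\ \varphi\ } \mathrm{SAut}^+(\mathcal{A})\rightarrow 1 \] and \[ 1\rightarrow \mathrm{SAut}^+(\mathcal{A}) \rightarrow \mathrm{Aut}^+(\mathcal{A}) \xrightarrow{\ \phi\ } L_n/P_n \rightarrow 1 .\]
   Context: **Labeled seeds.** Let $\mathcal{F}$ be a field isomorphic to the field of rational functions in $n$ variables over $\mathbb{Q}$, and $[1,n]=\{1,\dots,n\}$. A labeled seed (of rank $n$) is a pair $(\mathbf{x},B)$ with $\mathbf{x}=(x_1,\dots,x_n)$ an $n$-tuple of free generators of $\mathcal{F}$ and $B=(b_{ij})$ an $n\times n$ skew-symmetrizable integer matrix (i.e. $DB$ is skew-symmetric for some positive diagonal integer matrix $D$). Standing assumption: $B$ is indecomposable (for any $i,j$ there are $i=i_0,\dots,i_k=j$ with $b_{i_0i_1}\cdots b_{i_{k-1}i_k}\neq0$). With $[a]_+=\max(a,0)$, the mutation $\mu_k(\mathbf{x},B)=(\mathbf{x}',B')$, $k\in[1,n]$, is given by $x'_k=\big(\prod_i x_i^{[b_{ik}]_+}+\prod_i x_i^{[-b_{ik}]_+}\big)/x_k$, $x'_i=x_i$ for $i\ne k$; $b'_{ij}=-b_{ij}$ if $i=k$ or $j=k$, and $b'_{ij}=b_{ij}+\mathrm{sgn}(b_{ik})[b_{ik}b_{kj}]_+$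 otherwise; write $B'=\mu_k(B)$. Each $\mu_k$ is an involution. Two labeled seeds are mutation equivalent if they are related by a finite sequence of mutations. An (unlabeled) seed is a class of labeled seeds up to simultaneous relabeling of $\mathbf{x}$ and of the rows and columns of $B$. The cluster algebra $\mathcal{A}(\mathbf{x},B)$ (trivial coefficients) is the $\mathbb{Z}$-subalgebra of $\mathcal{F}$ generated by all entries (cluster variables) of the tuples (labeled clusters) in labeled seeds mutation equivalent to $(\mathbf{x},B)$; the seeds of $\mathcal{A}$ are those represented by such labeled seeds, and the set of cluster variables of a seed is a cluster. A seed is determined by its cluster; $B(\mathbf{x}')$ denotes the exchange matrix belonging to the cluster $\mathbf{x}'$, indexed compatibly with the chosen ordering of $\mathbf{x}'$. **Periods and groups.** For a finite sequence $\mathbf{i}=(i_1,\dots,i_s)$ in $I=[1,n]$ (an $I$-sequence), $\mu_{\mathbf{i}}=\mu_{i_s}\cdots\mu_{i_2}\mu_{i_1}$. It is a period of $B$ if $\mu_{\mathbf{i}}(B)=B$, and a period of $(\mathbf{x},B)$ if $\mu_{\mathbf{i}}(\mathbf{x},B)=(\mathbf{x},B)$ as labeled seeds. The mutation group is $\langle\mu_1,\dots,\mu_n:\mu_i^2=1\rangle$. $G(B)$ is the opposite group of its subgroup of all $\mu_{\mathbf{i}}$ with $\mathbf{i}$ a period of $B$, and $H(\mathbf{x})=H(\mathbf{x},B)$ is the opposite group of its subgroup of all $\mu_{\mathbf{i}}$ with $\mathbf{i}$ a period of $(\mathbf{x},B)$; thus the product is $\mu_{\mathbf{i}}\circ\mu_{\mathbf{j}}=\mu_{\mathbf{j}}\mu_{\mathbf{i}}$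 (first $\mu_{\mathbf{i}}$, then $\mu_{\mathbf{j}}$). **Permutations.** For $\sigma\in S_n$, $(\mathbf{x},B)^\sigma=(\mathbf{x}^\sigma,B^\sigma)$ with $\mathbf{x}^\sigma=(x_{\sigma(i)})_i$ and $B^\sigma=(b_{\sigma(i)\sigma(j)})_{i,j}$. Put $L_n=\{\sigma\in S_n:\ \mu_{\mathbf{i}}(B)=B^\sigma\text{ for some }I\text{-sequence }\mathbf{i}\}$ and $P_n=\{\tau\in S_n:\ \mu_{\mathbf{j}}(\mathbf{x},B)=(\mathbf{x}^\tau,B^\tau)\text{ for some }I\text{-sequence }\mathbf{j}\}$; $P_n$ is a normal subgroup of the group $L_n$. **Cluster automorphisms.** A $\mathbb{Z}$-algebra automorphism $f$ of $\mathcal{A}$ is a cluster automorphism if there is a seed $(\mathbf{x}',B')$ of $\mathcal{A}$ such that (1) $f(\mathbf{x}')$ is a cluster, and (2) $f$ is compatible with mutations: $f(\mu_{x,\mathbf{x}'}(x))=\mu_{f(x),f(\mathbf{x}')}(f(x))$ for every $x\in\mathbf{x}'$, where $\mu_{x,\mathbf{x}'}(x)$ is the new cluster variable obtained by mutating the seed with cluster $\mathbf{x}'$ at $x$. It is direct if $B(f(\mathbf{x}'))=B'$ for every seed $(\mathbf{x}',B')$, where the $i$-th variable of $f(\mathbf{x}')$ is $f(x'_i)$. $\mathrm{Aut}^+(\mathcal{A})$ is the group of direct cluster automorphisms. A $\mathbb{Z}$-algebra automorphism $f$ is a strict cluster automorphism if there is a labeled seed $(\mathbf{x}',B')$ of $\mathcal{A}$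 such that $(f(\mathbf{x}'),B(f(\mathbf{x}')))=\mu_{i_k}\cdots\mu_{i_1}(\mathbf{x}',B')$ as labeled seeds for some mutation sequence, and $f$ is compatible with mutations as in (2). It is strict direct if moreover $B(f(\mathbf{x}))=B$. $\mathrm{SAut}^+(\mathcal{A})\subseteq\mathrm{Aut}^+(\mathcal{A})$ is the subgroup of strict direct cluster automorphisms. The maps $H(\mathbf{x})\to G(B)$ and $\mathrm{SAut}^+(\mathcal{A})\to\mathrm{Aut}^+(\mathcal{A})$ are the inclusions. *)

theory Defs
  imports
    "HOL-Library.Poly_Mapping"
    "HOL-Algebra.Bij"
    "HOL-Algebra.Coset"
    "HOL-Algebra.Generated_Rings"
    "HOL-Algebra.Algebraic_Closure_Type"
begin

text \<open>
  The rank is \<open>n = CARD('n)\<close>: the index set \<open>[1,n]\<close> is the universe of the finite type \<open>'n\<close>.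
  The ambient field is the universe of a type \<open>'f\<close> of characteristic zero. It is a
  rational function field in \<open>n\<close> variables over the rationals precisely when it has an
  \<open>n\<close>-tuple of free generators, which every labeled seed provides.
\<close>

section \<open>Labeled seeds and mutations\<close>

definition poly_eval :: "('n \<Rightarrow> 'f) \<Rightarrow> (('n \<Rightarrow>\<^sub>0 nat) \<Rightarrow>\<^sub>0 rat) \<Rightarrow> 'f::field_char_0" where
  "poly_eval x p =
     (\<Sum>m\<in>Poly_Mapping.keys p. of_rat (Poly_Mapping.lookup p m) *
        (\<Prod>i\<in>Poly_Mapping.keys m. x i ^ Poly_Mapping.lookup m i))"

definition free_generators :: "('n \<Rightarrow> 'f::field_char_0) \<Rightarrow> bool" where
  "free_generators x \<longleftrightarrow>
     (\<forall>p. poly_eval x p = 0 \<longrightarrow> p = 0) \<and>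
     (\<forall>z. \<exists>p q. poly_eval x q \<noteq> 0 \<and> z = poly_eval x p / poly_eval x q)"

definition skew_symmetrizable :: "('n \<Rightarrow> 'n \<Rightarrow> int) \<Rightarrow> bool" where
  "skew_symmetrizable B \<longleftrightarrow>
     (\<exists>d :: 'n \<Rightarrow> int. (\<forall>i. d i > 0) \<and> (\<forall>i j. d i * B i j = - (d j * B j i)))"

definition indecomposable :: "('n \<Rightarrow> 'n \<Rightarrow> int) \<Rightarrow> bool" where
  "indecomposable B \<longleftrightarrow> (\<forall>i j. (\<lambda>a b. B a b \<noteq> 0)\<^sup>*\<^sup>* i j)"

type_synonym ('n, 'f) lseed = "('n \<Rightarrow> 'f) \<times> ('n \<Rightarrow> 'n \<Rightarrow> int)"

definition labeled_seed :: "('n::finite, 'f::field_char_0) lseed \<Rightarrow> bool" where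
  "labeled_seed s \<longleftrightarrow>
     free_generators (fst s) \<and> skew_symmetrizable (snd s) \<and> indecomposable (snd s)"

definition mut_matrix :: "'n \<Rightarrow> ('n \<Rightarrow> 'n \<Rightarrow> int) \<Rightarrow> ('n \<Rightarrow> 'n \<Rightarrow> int)" where
  "mut_matrix k B = (\<lambda>i j. if i = k \<or> j = k then - B i j
                           else B i j + sgn (B i k) * max (B i k * B k j) 0)"

text \<open>The exponents \<open>[b]\<^sub>+\<close> are rendered by \<^term>\<open>nat b\<close>, which truncates negative integers to zero.\<close>

definition mut_var :: "'n::finite \<Rightarrow> ('n, 'f::field_char_0) lseed \<Rightarrow> 'f" where
  "mut_var k s = (case s of (x, B) \<Rightarrow>
     ((\<Prod>i\<in>UNIV. x i ^ nat (B i k)) + (\<Prod>i\<in>UNIV. x i ^ nat (- B i k))) / x k)"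

definition mut :: "'n::finite \<Rightarrow> ('n, 'f::field_char_0) lseed \<Rightarrow> ('n, 'f) lseed" where
  "mut k s = ((fst s)(k := mut_var k s), mut_matrix k (snd s))"

text \<open>For \<open>w = [i\<^sub>1,\<dots>,i\<^sub>s]\<close> the mutation at \<open>i\<^sub>1\<close> is performed first.\<close>

definition mut_seq :: "'n list \<Rightarrow> ('n::finite, 'f::field_char_0) lseed \<Rightarrow> ('n, 'f) lseed" where
  "mut_seq w s = fold mut w s"

definition mut_matrix_seq :: "'n list \<Rightarrow> ('n \<Rightarrow> 'n \<Rightarrow> int) \<Rightarrow> ('n \<Rightarrow> 'n \<Rightarrow> int)" where
  "mut_matrix_seq w B = fold mut_matrix w B"

definition perm_matrix :: "('n \<Rightarrow> 'n) \<Rightarrow> ('n \<Rightarrow> 'n \<Rightarrow> int) \<Rightarrow> ('n \<Rightarrow> 'n \<Rightarrow> int)" where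
  "perm_matrix \<sigma> B = (\<lambda>i j. B (\<sigma> i) (\<sigma> j))"

definition perm_seed :: "('n \<Rightarrow> 'n) \<Rightarrow> ('n, 'f) lseed \<Rightarrow> ('n, 'f) lseed" where
  "perm_seed \<sigma> s = (fst s \<circ> \<sigma>, perm_matrix \<sigma> (snd s))"


section \<open>The cluster algebra\<close>

definition mut_class :: "('n::finite, 'f::field_char_0) lseed \<Rightarrow> ('n, 'f) lseed set" where
  "mut_class s = {mut_seq w s | w. True}"

definition cluster_algebra :: "('n::finite, 'f::field_char_0) lseed \<Rightarrow> 'f ring" where
  "cluster_algebra s = ring_of_type_algebra
     \<lparr>carrier := generate_ring ring_of_type_algebra (\<Union>t\<in>mut_class s. range (fst t))\<rparr>"

text \<open>
  The labeled representatives of the (unlabeled) seeds of the cluster algebra: all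
  relabelings of labeled seeds mutation equivalent to \<open>s\<close>.  Since a seed is determined by
  its cluster, \<open>B(y)\<close> is the matrix \<open>C\<close> with \<open>(y, C) \<in> seeds s\<close>; accordingly \<open>B(y) = C\<close> is
  written as \<open>(y, C) \<in> seeds s\<close> below.
\<close>

definition seeds :: "('n::finite, 'f::field_char_0) lseed \<Rightarrow> ('n, 'f) lseed set" where
  "seeds s = {perm_seed \<sigma> t | \<sigma> t. bij \<sigma> \<and> t \<in> mut_class s}"

definition clusters :: "('n::finite, 'f::field_char_0) lseed \<Rightarrow> 'f set set" where
  "clusters s = (\<lambda>t. range (fst t)) ` seeds s"


section \<open>Cluster automorphisms\<close>

text \<open>
  Maps on the cluster algebra are extensional (\<open>undefined\<close> outside of it), so that equality of
  functions is equality of maps.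
\<close>

definition alg_auts :: "('n::finite, 'f::field_char_0) lseed \<Rightarrow> ('f \<Rightarrow> 'f) set" where
  "alg_auts s =
     ring_iso (cluster_algebra s) (cluster_algebra s) \<inter> extensional (carrier (cluster_algebra s))"

text \<open>
  \<open>f (\<mu>\<^bsub>x,y\<^esub>(x)) = \<mu>\<^bsub>f(x),f(y)\<^esub>(f(x))\<close> for all \<open>x\<close> in the cluster \<open>y\<close>, where \<open>C = B(f(y))\<close>.
\<close>

definition mut_compatible ::
  "('f \<Rightarrow> 'f) \<Rightarrow> ('n::finite, 'f::field_char_0) lseed \<Rightarrow> ('n \<Rightarrow> 'n \<Rightarrow> int) \<Rightarrow> bool" where
  "mut_compatible f t C \<longleftrightarrow> (\<forall>k. f (mut_var k t) = mut_var k (f \<circ> fst t, C))"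

definition cluster_aut :: "('n::finite, 'f::field_char_0) lseed \<Rightarrow> ('f \<Rightarrow> 'f) \<Rightarrow> bool" where
  "cluster_aut s f \<longleftrightarrow> f \<in> alg_auts s \<and>
     (\<exists>t\<in>seeds s. f ` range (fst t) \<in> clusters s \<and>
        (\<exists>C. (f \<circ> fst t, C) \<in> seeds s \<and> mut_compatible f t C))"

definition direct_cluster_aut :: "('n::finite, 'f::field_char_0) lseed \<Rightarrow> ('f \<Rightarrow> 'f) \<Rightarrow> bool" where
  "direct_cluster_aut s f \<longleftrightarrow> cluster_aut s f \<and>
     (\<forall>t\<in>seeds s. (f \<circ> fst t, snd t) \<in> seeds s)"

definition strict_cluster_aut :: "('n::finite, 'f::field_char_0) lseed \<Rightarrow> ('f \<Rightarrow> 'f) \<Rightarrow> bool" where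
  "strict_cluster_aut s f \<longleftrightarrow> f \<in> alg_auts s \<and>
     (\<exists>t\<in>seeds s. \<exists>C. (f \<circ> fst t, C) \<in> seeds s \<and>
        (\<exists>w. (f \<circ> fst t, C) = mut_seq w t) \<and> mut_compatible f t C)"

definition strict_direct_cluster_aut ::
  "('n::finite, 'f::field_char_0) lseed \<Rightarrow> ('f \<Rightarrow> 'f) \<Rightarrow> bool" where
  "strict_direct_cluster_aut s f \<longleftrightarrow> strict_cluster_aut s f \<and> (f \<circ> fst s, snd s) \<in> seeds s"

definition Aut_plus :: "('n::finite, 'f::field_char_0) lseed \<Rightarrow> ('f \<Rightarrow> 'f) monoid" where
  "Aut_plus s = (BijGroup (carrier (cluster_algebra s)))\<lparr>carrier := {f. direct_cluster_aut s f}\<rparr>"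

definition SAut_plus :: "('n::finite, 'f::field_char_0) lseed \<Rightarrow> ('f \<Rightarrow> 'f) monoid" where
  "SAut_plus s =
     (BijGroup (carrier (cluster_algebra s)))\<lparr>carrier := {f. strict_direct_cluster_aut s f}\<rparr>"


section \<open>The mutation group and the groups of periods\<close>

text \<open>
  The group \<open>\<langle>\<mu>\<^sub>i : \<mu>\<^sub>i\<^sup>2 = 1\<rangle>\<close> consists of words in the generators (inverses of generators are not
  needed, as \<open>\<mu>\<^sub>i\<close> is its own inverse) modulo insertion and deletion of squares of generators.
\<close>

definition word_equiv :: "('n list \<times> 'n list) set" where
  "word_equiv = (let r = {(u @ v, u @ [i, i] @ v) | u v i. True} in (r \<union> r\<inverse>)\<^sup>*)"

definition mutation_group :: "'n list set monoid" where
  "mutation_group =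
     \<lparr>carrier = UNIV // word_equiv,
      monoid.mult = (\<lambda>U V. \<Union>u\<in>U. \<Union>v\<in>V. word_equiv `` {u @ v}),
      one = word_equiv `` {[]}\<rparr>"

text \<open>The element \<open>\<mu>\<^bsub>i\<^esub> = \<mu>\<^bsub>i\<^sub>s\<^esub> \<cdots> \<mu>\<^bsub>i\<^sub>1\<^esub>\<close> for \<open>i = [i\<^sub>1,\<dots>,i\<^sub>s]\<close>: the word is written in reverse order.\<close>

definition mu :: "'n list \<Rightarrow> 'n list set" where
  "mu w = word_equiv `` {rev w}"

definition opposite_group :: "'a monoid \<Rightarrow> 'a monoid" where
  "opposite_group G = G\<lparr>monoid.mult := (\<lambda>a b. b \<otimes>\<^bsub>G\<^esub> a)\<rparr>"

definition G_group :: "('n \<Rightarrow> 'n \<Rightarrow> int) \<Rightarrow> 'n list set monoid" where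
  "G_group B = opposite_group (mutation_group\<lparr>carrier := {mu w | w. mut_matrix_seq w B = B}\<rparr>)"

definition H_group :: "('n::finite, 'f::field_char_0) lseed \<Rightarrow> 'n list set monoid" where
  "H_group s = opposite_group (mutation_group\<lparr>carrier := {mu w | w. mut_seq w s = s}\<rparr>)"


section \<open>Permutations\<close>

definition L_set :: "('n \<Rightarrow> 'n \<Rightarrow> int) \<Rightarrow> ('n \<Rightarrow> 'n) set" where
  "L_set B = {\<sigma>. bij \<sigma> \<and> (\<exists>w. mut_matrix_seq w B = perm_matrix \<sigma> B)}"

definition P_set :: "('n::finite, 'f::field_char_0) lseed \<Rightarrow> ('n \<Rightarrow> 'n) set" where
  "P_set s = {\<tau>. bij \<tau> \<and> (\<exists>w. mut_seq w s = perm_seed \<tau> s)}"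

definition L_group :: "('n \<Rightarrow> 'n \<Rightarrow> int) \<Rightarrow> ('n \<Rightarrow> 'n) monoid" where
  "L_group B = (BijGroup UNIV)\<lparr>carrier := L_set B\<rparr>"


section \<open>Exact sequences\<close>

text \<open>
  Exactness of \<open>1 \<rightarrow> A \<rightarrow> B \<rightarrow> C \<rightarrow> 1\<close>.  The library's \<open>short_exact_sequence\<close> (theory
  \<open>Exact_Sequence\<close>) forces all groups to have elements of the same type.
\<close>

definition short_exact ::
  "('a, 'm) monoid_scheme \<Rightarrow> ('b, 'p) monoid_scheme \<Rightarrow> ('c, 'q) monoid_scheme \<Rightarrow>
     ('a \<Rightarrow> 'b) \<Rightarrow> ('b \<Rightarrow> 'c) \<Rightarrow> bool" where
  "short_exact A B C f g \<longleftrightarrow>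
     group_hom A B f \<and> group_hom B C g \<and>
     kernel A B f = {\<one>\<^bsub>A\<^esub>} \<and> kernel B C g = f ` carrier A \<and> g ` carrier B = carrier C"

end

theory Submission
  imports Defs
begin

text \<open>
  A direct cluster automorphism is determined by the images of the initial cluster variables,
  and these may be the entries of any seed of the algebra that carries the initial matrix \<open>B\<close>.
  The reason is that the cluster \<open>x\<close> is algebraically independent and generates the field: for
  every other free generating tuple \<open>y\<close> there is exactly one field automorphism with
  \<open>x \<mapsto> y\<close>, it commutes with mutation if \<open>y\<close> carries the same matrix, and it maps the cluster
  algebra onto itself if \<open>(y, B)\<close> is one of its seeds. So the elements of \<open>Aut\<^sup>+\<close> correspond to the
  seeds \<open>(\<mu>\<^sub>w (x, B))\<^sup>\<sigma>\<close> with matrix \<open>B\<close> (\<open>direct_cluster_aut_iff\<close>), and those of \<open>SAut\<^sup>+\<close> to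
  the ones that can be reached without a relabeling \<open>\<sigma>\<close> (\<open>strict_direct_cluster_aut_iff\<close>).

  Both sequences can be read off from this. A period \<open>w\<close> of \<open>B\<close> is sent to the automorphism that
  takes the initial seed to \<open>\<mu>\<^sub>w (x, B)\<close>; it is trivial exactly if \<open>w\<close> is a period of the seed. A direct
  automorphism with image \<open>(\<mu>\<^sub>w (x, B))\<^sup>\<sigma>\<close> is sent to \<open>\<sigma>\<close>, which is unique up to the permutations
  \<open>\<tau>\<close> for which \<open>(x, B)\<^sup>\<tau>\<close> itself is mutation equivalent to \<open>(x, B)\<close>, that is, up to \<open>P\<^sub>n\<close>.

  One step is not formal. The definition of a strict direct automorphism \<open>f\<close> only provides some
  seed \<open>t = (y, C)\<close> and some matrix \<open>C'\<close> with \<open>(f y, C') = \<mu>\<^sub>w t\<close>, compatibly with mutations, whereas the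
  description above needs \<open>C' = C\<close>. Compatibility says that \<open>C\<close> and \<open>C'\<close> have the same exchange
  polynomials, so their columns agree up to sign (\<open>exchange_column_unique\<close>), and indecomposability
  turns this into \<open>C' = C\<close> or \<open>C' = -C\<close>. If \<open>C' = -C\<close>, then \<open>(z, C)\<close> and \<open>(z, -C)\<close>, with \<open>z = f y\<close>,
  are both seeds, and therefore \<open>\<mu>\<^sub>w (z, C) = (z, -C)\<^sup>\<tau>\<close> for some \<open>w\<close> and \<open>\<tau>\<close>. This forces \<open>C = 0\<close>
  (\<open>opposite_seed_not_equivalent\<close>): if \<open>d\<close> symmetrizes \<open>C\<close>, the two-form
  \<open>\<Sum>\<^sub>i\<^sub>j (c\<^sub>i\<^sub>j / d\<^sub>j) dlog z\<^sub>i \<and> dlog z\<^sub>j\<close> is invariant under mutation, and \<open>\<tau>\<close> preserves \<open>d\<close>, so that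
  the form is equal to its own negative.

  All transfers of identities between tuples, including the passage to positive real numbers where
  the logarithmic derivatives are taken, rest on one device: a rational expression in algebraically
  independent elements may be evaluated at any point where a denominator does not vanish
  (\<open>specializes\<close>).
\<close>


section \<open>Evaluation of polynomials\<close>

lemma monomial_over_UNIV:
  fixes x :: "'n::finite \<Rightarrow> 'k::comm_semiring_1"
  shows "(\<Prod>i\<in>Poly_Mapping.keys m. x i ^ Poly_Mapping.lookup m i) =
         (\<Prod>i\<in>UNIV. x i ^ Poly_Mapping.lookup m i)"
  by (rule prod.mono_neutral_left) (auto simp: in_keys_iff)

lemma poly_eval_superset:
  fixes x :: "'n::finite \<Rightarrow> 'k::field_char_0"
  assumes "finite K" "Poly_Mapping.keys p \<subseteq> K"
  shows "poly_eval x p =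
    (\<Sum>m\<in>K. of_rat (Poly_Mapping.lookup p m) * (\<Prod>i\<in>UNIV. x i ^ Poly_Mapping.lookup m i))"
  unfolding poly_eval_def monomial_over_UNIV
  by (rule sum.mono_neutral_left) (use assms in \<open>auto simp: in_keys_iff\<close>)

lemma poly_eval_add:
  fixes x :: "'n::finite \<Rightarrow> 'k::field_char_0"
  shows "poly_eval x (p + q) = poly_eval x p + poly_eval x q"
proof -
  let ?K = "Poly_Mapping.keys p \<union> Poly_Mapping.keys q"
  have "poly_eval x r = (\<Sum>m\<in>?K. of_rat (Poly_Mapping.lookup r m) *
          (\<Prod>i\<in>UNIV. x i ^ Poly_Mapping.lookup m i))" if "r \<in> {p, q, p + q}" for r
    by (rule poly_eval_superset) (use that keys_add[of p q] in auto)
  then show ?thesis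
    by (simp add: lookup_add of_rat_add distrib_right sum.distrib)
qed

lemma poly_eval_single:
  fixes x :: "'n::finite \<Rightarrow> 'k::field_char_0"
  shows "poly_eval x (Poly_Mapping.single m c) =
    of_rat c * (\<Prod>i\<in>UNIV. x i ^ Poly_Mapping.lookup m i)"
  by (subst poly_eval_superset[of "{m}"]) auto

lemma poly_eval_0 [simp]: "poly_eval x 0 = 0"
  by (simp add: poly_eval_def)

lemma poly_eval_1 [simp]:
  fixes x :: "'n::finite \<Rightarrow> 'k::field_char_0"
  shows "poly_eval x 1 = 1"
  using poly_eval_single[of x 0 1] by simp

lemma poly_mapping_add_induct [case_names zero single add]:
  assumes "P 0" and "\<And>m c. P (Poly_Mapping.single m c)"
    and "\<And>p q. P p \<Longrightarrow> P q \<Longrightarrow> P (p + q)"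
  shows "P (p :: 'a \<Rightarrow>\<^sub>0 'b::monoid_add)"
proof (induction p rule: update_induct)
  case const
  have "Abs_poly_mapping (\<lambda>_. 0) = (0 :: 'a \<Rightarrow>\<^sub>0 'b)" by simp
  then show ?case using assms(1) by simp
next
  case (update p m c)
  have "Poly_Mapping.update m c p = p + Poly_Mapping.single m c"
    using update by (intro poly_mapping_eqI)
      (auto simp: lookup_update lookup_add lookup_single when_def in_keys_iff)
  then show ?case using assms(2,3) update by metis
qed

lemma poly_eval_mult:
  fixes x :: "'n::finite \<Rightarrow> 'k::field_char_0"
  shows "poly_eval x (p * q) = poly_eval x p * poly_eval x q"
proof (induction p rule: poly_mapping_add_induct)
  case (single m c)
  show ?case
  proof (induction q rule: poly_mapping_add_induct)
    case (single m' c')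
    then show ?case
      by (simp add: mult_single poly_eval_single lookup_add power_add prod.distrib of_rat_mult)
  qed (simp_all add: poly_eval_add distrib_left)
qed (simp_all add: poly_eval_add distrib_right)

lemma poly_eval_uminus:
  fixes x :: "'n::finite \<Rightarrow> 'k::field_char_0"
  shows "poly_eval x (- p) = - poly_eval x p"
  using poly_eval_add[of x p "- p"] by (simp add: eq_neg_iff_add_eq_0 add.commute)

lemma poly_eval_diff:
  fixes x :: "'n::finite \<Rightarrow> 'k::field_char_0"
  shows "poly_eval x (p - q) = poly_eval x p - poly_eval x q"
  using poly_eval_add[of x p "- q"] by (simp add: poly_eval_uminus)

lemma poly_eval_var:
  fixes x :: "'n::finite \<Rightarrow> 'k::field_char_0"
  shows "poly_eval x (Poly_Mapping.single (Poly_Mapping.single i 1) 1) = x i"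
proof -
  have "(\<Prod>j\<in>UNIV. x j ^ Poly_Mapping.lookup (Poly_Mapping.single i 1) j) =
        (\<Prod>j\<in>{i}. x j ^ Poly_Mapping.lookup (Poly_Mapping.single i 1) j)"
    by (rule prod.mono_neutral_right) (auto simp: lookup_single when_def)
  then show ?thesis by (simp add: poly_eval_single)
qed


section \<open>Specialization of rational functions\<close>

definition alg_independent :: "('n \<Rightarrow> 'k::field_char_0) \<Rightarrow> bool" where
  "alg_independent x \<longleftrightarrow> (\<forall>p. poly_eval x p = 0 \<longrightarrow> p = 0)"

text \<open>
  The graph of the partial map that evaluates, at \<open>a\<close>, the elements of the field generated by \<open>x\<close>.
  The target field may differ from the source, and the relation is used with \<open>a\<close> a second free
  generating tuple, with \<open>a\<close> a mutated or relabeled cluster, and with \<open>a\<close> a point of the positive real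
  orthant. Asking for \<open>q(x) \<noteq> 0\<close> as well as \<open>q(a) \<noteq> 0\<close> makes it symmetric and closed under sums
  and products for arbitrary \<open>x\<close> and \<open>a\<close>.
\<close>

definition specializes ::
  "('n \<Rightarrow> 'f::field_char_0) \<Rightarrow> ('n \<Rightarrow> 'k::field_char_0) \<Rightarrow> 'f \<Rightarrow> 'k \<Rightarrow> bool" where
  "specializes x a u v \<longleftrightarrow> (\<exists>p q. poly_eval x q \<noteq> 0 \<and> poly_eval a q \<noteq> 0 \<and>
     u = poly_eval x p / poly_eval x q \<and> v = poly_eval a p / poly_eval a q)"

definition ratfun :: "('n \<Rightarrow> 'f::field_char_0) \<Rightarrow> 'f \<Rightarrow> bool" where
  "ratfun x z \<longleftrightarrow> (\<exists>p q. poly_eval x q \<noteq> 0 \<and> z = poly_eval x p / poly_eval x q)"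

lemma free_generators_iff: "free_generators x \<longleftrightarrow> alg_independent x \<and> (\<forall>z. ratfun x z)"
  by (simp add: free_generators_def alg_independent_def ratfun_def)

lemma ratfun_iff_specializes: "ratfun x z \<longleftrightarrow> specializes x x z z"
  by (auto simp: ratfun_def specializes_def)

context
  fixes x :: "'n::finite \<Rightarrow> 'f::field_char_0" and a :: "'n \<Rightarrow> 'k::field_char_0"
begin

lemma specializes_poly_eval: "specializes x a (poly_eval x p) (poly_eval a p)"
  unfolding specializes_def by (intro exI[of _ p] exI[of _ 1]) simp

lemma specializes_var: "specializes x a (x i) (a i)"
  using specializes_poly_eval[of "Poly_Mapping.single (Poly_Mapping.single i 1) 1"]
  unfolding poly_eval_var .

lemma specializes_of_rat: "specializes x a (of_rat c) (of_rat c)"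
  using specializes_poly_eval[of "Poly_Mapping.single 0 c"]
  by (simp add: poly_eval_single)

lemma specializes_0: "specializes x a 0 0" and specializes_1: "specializes x a 1 1"
  using specializes_of_rat[of 0] specializes_of_rat[of 1] by simp_all

lemma specializes_add:
  assumes "specializes x a u v" "specializes x a u' v'"
  shows "specializes x a (u + u') (v + v')"
proof -
  obtain p q p' q' where "poly_eval x q \<noteq> 0" "poly_eval a q \<noteq> 0"
      "poly_eval x q' \<noteq> 0" "poly_eval a q' \<noteq> 0"
      "u = poly_eval x p / poly_eval x q" "v = poly_eval a p / poly_eval a q"
      "u' = poly_eval x p' / poly_eval x q'" "v' = poly_eval a p' / poly_eval a q'"
    using assms unfolding specializes_def by blast
  then show ?thesis
    unfolding specializes_def
    by (intro exI[of _ "p * q' + p' * q"] exI[of _ "q * q'"])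
      (simp add: poly_eval_add poly_eval_mult add_frac_eq)
qed

lemma specializes_mult:
  assumes "specializes x a u v" "specializes x a u' v'"
  shows "specializes x a (u * u') (v * v')"
proof -
  obtain p q p' q' where "poly_eval x q \<noteq> 0" "poly_eval a q \<noteq> 0"
      "poly_eval x q' \<noteq> 0" "poly_eval a q' \<noteq> 0"
      "u = poly_eval x p / poly_eval x q" "v = poly_eval a p / poly_eval a q"
      "u' = poly_eval x p' / poly_eval x q'" "v' = poly_eval a p' / poly_eval a q'"
    using assms unfolding specializes_def by blast
  then show ?thesis
    unfolding specializes_def
    by (intro exI[of _ "p * p'"] exI[of _ "q * q'"]) (simp add: poly_eval_mult)
qed

lemma specializes_uminus:
  assumes "specializes x a u v"
  shows "specializes x a (- u) (- v)"
  using specializes_mult[OF specializes_of_rat[of "-1"] assms] by (simp add: of_rat_minus)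

lemma specializes_power: "specializes x a u v \<Longrightarrow> specializes x a (u ^ n) (v ^ n)"
  by (induction n) (auto intro: specializes_mult specializes_1)

lemma specializes_prod:
  "(\<And>i. i \<in> I \<Longrightarrow> specializes x a (u i) (v i)) \<Longrightarrow> specializes x a (prod u I) (prod v I)"
  by (induction I rule: infinite_finite_induct) (auto intro: specializes_mult specializes_1)

lemma specializes_sum:
  "(\<And>i. i \<in> I \<Longrightarrow> specializes x a (u i) (v i)) \<Longrightarrow> specializes x a (sum u I) (sum v I)"
  by (induction I rule: infinite_finite_induct) (auto intro: specializes_add specializes_0)

text \<open>
  Composition of substitutions: if \<open>y\<close> specializes to \<open>b\<close>, a relation \<open>p(y) = 0\<close> becomes the
  relation \<open>p(b) = 0\<close> as soon as \<open>x\<close> is algebraically independent.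
\<close>

lemma specializes_substitute:
  assumes "\<And>i. specializes x a (y i) (b i)"
  shows "specializes x a (poly_eval y p) (poly_eval b p)"
  unfolding poly_eval_def
  by (intro specializes_sum specializes_mult specializes_prod specializes_power
      specializes_of_rat assms)

text \<open>
  Two representations \<open>p/q = p'/q'\<close> in terms of \<open>x\<close> give the polynomial identity
  \<open>pq' = p'q\<close>, because \<open>x\<close> satisfies no other relations; it can be evaluated at \<open>a\<close>.
\<close>

lemma specializes_functional:
  assumes "alg_independent x" "specializes x a u v" "specializes x a u v'"
  shows "v = v'"
proof -
  obtain p q p' q' where *: "poly_eval x q \<noteq> 0" "poly_eval a q \<noteq> 0"
      "poly_eval x q' \<noteq> 0" "poly_eval a q' \<noteq> 0"
      "u = poly_eval x p / poly_eval x q" "v = poly_eval a p / poly_eval a q"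
      "u = poly_eval x p' / poly_eval x q'" "v' = poly_eval a p' / poly_eval a q'"
    using assms(2,3) unfolding specializes_def by blast
  then have "poly_eval x p * poly_eval x q' = poly_eval x p' * poly_eval x q"
    by (simp add: frac_eq_eq)
  then have "poly_eval x (p * q' - p' * q) = 0"
    by (simp add: poly_eval_diff poly_eval_mult)
  then have "p * q' - p' * q = 0" using assms(1) unfolding alg_independent_def by blast
  then have "poly_eval a (p * q' - p' * q) = 0" by simp
  then show ?thesis
    using * by (simp add: poly_eval_diff poly_eval_mult frac_eq_eq)
qed

lemma specializes_inverse:
  assumes "alg_independent x" "specializes x a u v" "v \<noteq> 0"
  shows "specializes x a (inverse u) (inverse v)"
proof -
  obtain p q where *: "poly_eval x q \<noteq> 0" "poly_eval a q \<noteq> 0"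
      "u = poly_eval x p / poly_eval x q" "v = poly_eval a p / poly_eval a q"
    using assms(2) unfolding specializes_def by blast
  then have "poly_eval a p \<noteq> 0" using assms(3) by auto
  then have "poly_eval x p \<noteq> 0" using assms(1) by (auto simp: alg_independent_def)
  then show ?thesis
    unfolding specializes_def using * \<open>poly_eval a p \<noteq> 0\<close>
    \<open>poly_eval x p \<noteq> 0\<close>
    by (intro exI[of _ q] exI[of _ p]) simp
qed

lemma specializes_divide:
  assumes "alg_independent x" "specializes x a u v" "specializes x a u' v'" "v' \<noteq> 0"
  shows "specializes x a (u / u') (v / v')"
  unfolding divide_inverse using assms by (intro specializes_mult specializes_inverse)

end

lemma specializes_sym: "specializes x a u v \<longleftrightarrow> specializes a x v u"
  unfolding specializes_def by auto

lemma ratfun_divide: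
  fixes x :: "'n::finite \<Rightarrow> 'f::field_char_0"
  assumes "ratfun x u" "ratfun x v"
  shows "ratfun x (u / v)"
proof (cases "v = 0")
  case True
  then show ?thesis using specializes_0[of x x] by (simp add: ratfun_iff_specializes)
next
  case False
  obtain p q p' q' where "poly_eval x q \<noteq> 0" "u = poly_eval x p / poly_eval x q"
      "poly_eval x q' \<noteq> 0" "v = poly_eval x p' / poly_eval x q'"
    using assms unfolding ratfun_def by blast
  moreover from this False have "poly_eval x p' \<noteq> 0" by auto
  ultimately show ?thesis
    unfolding ratfun_def by (intro exI[of _ "p * q'"] exI[of _ "q * p'"])
      (simp add: poly_eval_mult)
qed

text \<open>
  How mutations and relabelings are seen to preserve free generation without any theory of
  transcendence degree. Write \<open>y = r(x)\<close>. The point \<open>a\<close> is chosen such that \<open>r(a) = x\<close> (for a mutation,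
  which is an involution, \<open>a = y\<close>), so a relation \<open>p(r(x)) = 0\<close> specializes at \<open>a\<close> to \<open>p(x) = 0\<close>.
\<close>

lemma free_generators_transfer:
  fixes x y :: "'n::finite \<Rightarrow> 'f::field_char_0"
  assumes "free_generators x" and a: "\<And>i. specializes x a (y i) (x i)"
    and y: "\<And>i. ratfun y (x i)"
  shows "free_generators y"
proof -
  have x: "alg_independent x" "ratfun x z" for z
    using assms(1) by (auto simp: free_generators_iff)
  have "alg_independent y"
    unfolding alg_independent_def
  proof (intro allI impI)
    fix p assume "poly_eval y p = 0"
    then have "specializes x a 0 (poly_eval x p)"
      using specializes_substitute[of x a y x p] a by simp
    then have "poly_eval x p = 0"
      using specializes_functional[OF x(1)] specializes_0 by blast
    then show "p = 0" using x(1) by (simp add: alg_independent_def)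
  qed
  moreover have "ratfun y z" for z
  proof -
    obtain p q where z: "z = poly_eval x p / poly_eval x q"
      using x(2) unfolding ratfun_def by blast
    have "ratfun y (poly_eval x r)" for r
      unfolding ratfun_iff_specializes
      by (rule specializes_substitute) (use y in \<open>simp add: ratfun_iff_specializes\<close>)
    then show ?thesis unfolding z by (intro ratfun_divide)
  qed
  ultimately show ?thesis by (simp add: free_generators_iff)
qed

lemma alg_independent_inj:
  fixes x :: "'n::finite \<Rightarrow> 'f::field_char_0"
  assumes "alg_independent x" "poly_eval x p = poly_eval x q"
  shows "p = q"
proof -
  have "poly_eval x (p - q) = 0" using assms(2) by (simp add: poly_eval_diff)
  then have "p - q = 0" using assms(1) unfolding alg_independent_def by blast
  then show ?thesis by simp
qed

lemma alg_independent_nonzero: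
  fixes x :: "'n::finite \<Rightarrow> 'f::field_char_0"
  assumes "alg_independent x"
  shows "x i \<noteq> 0"
proof
  assume "x i = 0"
  then have "Poly_Mapping.single (Poly_Mapping.single i (1::nat)) (1::rat) = 0"
    using assms poly_eval_var[of x i] unfolding alg_independent_def by metis
  then show False using lookup_single_eq[of "Poly_Mapping.single i (1::nat)" "1::rat"] by simp
qed


section \<open>Mutations\<close>

lemma mut_seq_simps [simp]:
  "mut_seq [] s = s" "mut_seq (k # w) s = mut_seq w (mut k s)"
  "mut_seq (v @ w) s = mut_seq w (mut_seq v s)"
  by (simp_all add: mut_seq_def)

lemma mut_matrix_seq_simps [simp]:
  "mut_matrix_seq [] B = B" "mut_matrix_seq (k # w) B = mut_matrix_seq w (mut_matrix k B)"
  "mut_matrix_seq (v @ w) B = mut_matrix_seq w (mut_matrix_seq v B)"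
  by (simp_all add: mut_matrix_seq_def)

lemma snd_mut_seq [simp]: "snd (mut_seq w s) = mut_matrix_seq w (snd s)"
  by (induction w arbitrary: s) (simp_all add: mut_def)

lemma mut_matrix_involution [simp]: "mut_matrix k (mut_matrix k B) = B"
  by (auto simp: mut_matrix_def fun_eq_iff sgn_minus)

lemma mut_matrix_seq_rev [simp]: "mut_matrix_seq (rev w) (mut_matrix_seq w B) = B"
  by (induction w arbitrary: B) simp_all

text \<open>
  The diagonal matrix is kept as an explicit parameter because one and the same \<open>d\<close> symmetrizes all
  matrices that are obtained by mutation; the invariance of the two-form below depends on this.
\<close>

definition symmetrizer :: "('n \<Rightarrow> int) \<Rightarrow> ('n \<Rightarrow> 'n \<Rightarrow> int) \<Rightarrow> bool" where
  "symmetrizer d B \<longleftrightarrow> (\<forall>i. d i > 0) \<and> (\<forall>i j. d i * B i j = - (d j * B j i))"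

lemma skew_symmetrizable_iff: "skew_symmetrizable B \<longleftrightarrow> (\<exists>d. symmetrizer d B)"
  by (simp add: skew_symmetrizable_def symmetrizer_def)

lemma symmetrizer_diag:
  assumes "symmetrizer d B"
  shows "B i i = 0"
proof -
  have "d i * B i i = - (d i * B i i)" "d i > 0" using assms unfolding symmetrizer_def by blast+
  then show ?thesis by simp
qed

lemma symmetrizer_sgn:
  assumes "symmetrizer d B"
  shows "sgn (B j i) = - sgn (B i j)"
proof -
  have "d i * B i j = - (d j * B j i)" "d i > 0" "d j > 0"
    using assms unfolding symmetrizer_def by blast+
  then have "sgn (B i j) = sgn (- B j i)"
    by (metis mult_minus_right mult_1 sgn_mult sgn_pos)
  then show ?thesis by (simp add: sgn_minus)
qed

text \<open>
  The mutation rule in terms of positive and negative parts, the form in which it is compatible with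
  multiplication by the positive numbers \<open>d\<^sub>i\<close>.
\<close>

lemma sgn_mult_max:
  fixes a b :: int
  shows "sgn a * max (a * b) 0 = max a 0 * max b 0 - max (- a) 0 * max (- b) 0"
  by (cases a "0::int" rule: linorder_cases; cases b "0::int" rule: linorder_cases)
    (auto simp: max_def mult_less_0_iff zero_less_mult_iff mult_le_0_iff)

lemma symmetrizer_mut_matrix:
  assumes "symmetrizer d B"
  shows "symmetrizer d (mut_matrix k B)"
proof -
  have d: "d i > 0" "d i * B i j = - (d j * B j i)" for i j
    using assms unfolding symmetrizer_def by blast+
  have scale: "d i * max x 0 = max (d i * x) 0" for i x
    using d(1)[of i] by (simp add: max_def mult_le_0_iff)
  have swap: "d i * max (B i j) 0 = d j * max (- B j i) 0"
    "d i * max (- B i j) 0 = d j * max (B j i) 0" for i j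
    unfolding scale using d(2)[of i j] by (simp_all add: max_def)
  have summand: "d i * (sgn (B i k) * max (B i k * B k j) 0) =
        - (d j * (sgn (B j k) * max (B j k * B k i) 0))" for i j
  proof -
    have "d i * (sgn (B i k) * max (B i k * B k j) 0) =
        (d i * max (B i k) 0) * max (B k j) 0 - (d i * max (- B i k) 0) * max (- B k j) 0"
      unfolding sgn_mult_max by (simp add: algebra_simps)
    also have "\<dots> = max (- B k i) 0 * (d k * max (B k j) 0) - max (B k i) 0 * (d k * max (- B k j) 0)"
      unfolding swap[of i k] by simp
    also have "\<dots> = max (- B k i) 0 * (d j * max (- B j k) 0) - max (B k i) 0 * (d j * max (B j k) 0)"
      unfolding swap[of k j] by simp
    also have "\<dots> = - (d j * (sgn (B j k) * max (B j k * B k i) 0))"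
      unfolding sgn_mult_max by (simp add: algebra_simps)
    finally show ?thesis .
  qed
  have "d i * mut_matrix k B i j = - (d j * mut_matrix k B j i)" for i j
    using d(2)[of i j] summand[of i j] by (simp add: mut_matrix_def distrib_left)
  then show ?thesis
    using d(1) unfolding symmetrizer_def by blast
qed

lemma symmetrizer_mut_matrix_seq:
  "symmetrizer d B \<Longrightarrow> symmetrizer d (mut_matrix_seq w B)"
  by (induction w arbitrary: B) (auto intro: symmetrizer_mut_matrix)

text \<open>
  An edge \<open>i - j\<close> can only disappear under mutation at \<open>k\<close> when it is cancelled by the path
  \<open>i - k - j\<close>, and the edges at \<open>k\<close> survive.
\<close>

lemma indecomposable_mut_matrix:
  assumes "indecomposable B"
  shows "indecomposable (mut_matrix k B)"
proof -
  let ?B' = "mut_matrix k B"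
  have edge: "(\<lambda>a b. ?B' a b \<noteq> 0)\<^sup>*\<^sup>* i j" if "B i j \<noteq> 0" for i j
  proof (cases "?B' i j = 0")
    case True
    with that have "i \<noteq> k" "j \<noteq> k" "max (B i k * B k j) 0 \<noteq> 0"
      by (auto simp: mut_matrix_def split: if_splits)
    then have "?B' i k \<noteq> 0" "?B' k j \<noteq> 0"
      by (auto simp: mut_matrix_def)
    then show ?thesis
      by (intro rtranclp.rtrancl_into_rtrancl[OF r_into_rtranclp[of _ i k]])
  qed auto
  have "(\<lambda>a b. ?B' a b \<noteq> 0)\<^sup>*\<^sup>* i j" if "(\<lambda>a b. B a b \<noteq> 0)\<^sup>*\<^sup>* i j" for i j
    using that by (induction) (auto intro: rtranclp_trans edge)
  then show ?thesis using assms by (simp add: indecomposable_def)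
qed

lemma specializes_mut_var:
  fixes x :: "'m::finite \<Rightarrow> 'f::field_char_0" and a :: "'m \<Rightarrow> 'k::field_char_0"
  assumes x: "alg_independent x" and "\<And>i. specializes x a (y i) (b i)" "b k \<noteq> 0"
  shows "specializes x a (mut_var k (y, B)) (mut_var k (b, B))"
  unfolding mut_var_def prod.case
  by (intro specializes_divide specializes_add specializes_prod specializes_power assms)

text \<open>
  At \<open>x = (1, \<dots>, 1)\<close> the new variable takes the value \<open>2\<close>.
\<close>

lemma mut_var_nonzero:
  fixes x :: "'n::finite \<Rightarrow> 'f::field_char_0"
  assumes "alg_independent x"
  shows "mut_var k (x, B) \<noteq> 0"
proof
  have "specializes x (\<lambda>_. 1 :: rat) (mut_var k (x, B)) (mut_var k (\<lambda>_. 1, B))"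
    by (intro specializes_mut_var assms specializes_var) simp
  moreover have "mut_var k (\<lambda>_. 1 :: rat, B) = 2"
    by (simp add: mut_var_def)
  moreover assume "mut_var k (x, B) = 0"
  ultimately have "specializes x (\<lambda>_. 1 :: rat) 0 2"
    by simp
  then show False
    using specializes_functional[OF assms _ specializes_0[of x]] by fastforce
qed

text \<open>
  The exchange polynomial at \<open>k\<close> does not involve \<open>x\<^sub>k\<close>, since \<open>b\<^sub>k\<^sub>k = 0\<close>, and changing the sign of the
  \<open>k\<close>-th column only exchanges its two monomials. Hence both \<open>B\<close> and its mutation lead back to \<open>x\<^sub>k\<close>.
\<close>

lemma mut_var_mut:
  fixes x :: "'n::finite \<Rightarrow> 'f::field_char_0"
  assumes "B k k = 0" "x k \<noteq> 0" "mut_var k (x, B) \<noteq> 0"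
  shows "mut_var k (x(k := mut_var k (x, B)), B) = x k"
    and "mut_var k (x(k := mut_var k (x, B)), mut_matrix k B) = x k"
proof -
  let ?y = "x(k := mut_var k (x, B))"
  have eq: "(\<Prod>i\<in>UNIV. ?y i ^ nat (c i)) = (\<Prod>i\<in>UNIV. x i ^ nat (c i))"
    if "c k = 0" for c :: "'n \<Rightarrow> int"
    using that by (intro prod.cong) auto
  show *: "mut_var k (?y, B) = x k"
    using assms eq[of "\<lambda>i. B i k"] eq[of "\<lambda>i. - B i k"]
    by (simp add: mut_var_def divide_simps split: if_splits)
  show "mut_var k (?y, mut_matrix k B) = x k"
    unfolding * [symmetric] by (simp add: mut_var_def mut_matrix_def add.commute)
qed

lemma labeled_seedD:
  assumes "labeled_seed s"
  shows "free_generators (fst s)" "alg_independent (fst s)" "ratfun (fst s) z"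
    "skew_symmetrizable (snd s)" "indecomposable (snd s)" "snd s i i = 0"
    "fst s i \<noteq> 0" "mut_var k s \<noteq> 0"
proof -
  show *: "free_generators (fst s)" "alg_independent (fst s)" "ratfun (fst s) z"
    "skew_symmetrizable (snd s)" "indecomposable (snd s)"
    using assms by (auto simp: labeled_seed_def free_generators_iff)
  show "snd s i i = 0"
    using *(4) symmetrizer_diag by (auto simp: skew_symmetrizable_iff)
  show "fst s i \<noteq> 0" using *(2) by (rule alg_independent_nonzero)
  show "mut_var k s \<noteq> 0" using mut_var_nonzero[OF *(2), of k "snd s"] by simp
qed

lemma mut_involution:
  assumes "labeled_seed s"
  shows "mut k (mut k s) = s"
  using labeled_seedD[OF assms] mut_var_mut(2)[of "snd s" k "fst s"]
  by (simp add: mut_def)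

lemma labeled_seed_mut:
  fixes s :: "('n::finite, 'f::field_char_0) lseed"
  assumes "labeled_seed s"
  shows "labeled_seed (mut k s)"
proof -
  obtain x B where s: "s = (x, B)" by (cases s)
  note x = labeled_seedD[OF assms, unfolded s fst_conv snd_conv]
  define y where "y = x(k := mut_var k (x, B))"
  have y: "mut_var k (y, B) = x k"
    unfolding y_def by (rule mut_var_mut) (use x in auto)
  have "free_generators y"
  proof (rule free_generators_transfer[OF x(1)])
    show "specializes x y (y i) (x i)" for i
    proof (cases "i = k")
      case True
      then show ?thesis
        using specializes_mut_var[OF x(2), of y x y k B] specializes_var[of x y] x(8) y
        by (simp add: y_def)
    next
      case False
      then show ?thesis using specializes_var[of x y i] by (simp add: y_def)
    qed
    show "ratfun y (x i)" for i
    proof (cases "i = k")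
      case True
      have "ratfun y (mut_var k (y, B))"
        unfolding mut_var_def prod.case ratfun_iff_specializes
        by (intro ratfun_divide[unfolded ratfun_iff_specializes] specializes_add specializes_prod
            specializes_power specializes_var)
      then show ?thesis using y True by simp
    next
      case False
      then show ?thesis using specializes_var[of y y i]
        by (simp add: ratfun_iff_specializes y_def)
    qed
  qed
  then show ?thesis
    using x(4,5) symmetrizer_mut_matrix indecomposable_mut_matrix
    by (fastforce simp: labeled_seed_def mut_def s y_def skew_symmetrizable_iff)
qed

lemma labeled_seed_mut_seq: "labeled_seed s \<Longrightarrow> labeled_seed (mut_seq w s)"
proof (induction w arbitrary: s)
  case (Cons k w)
  then show ?case using Cons.IH[OF labeled_seed_mut] by simp
qed simp

lemma mut_seq_rev [simp]: "labeled_seed s \<Longrightarrow> mut_seq (rev w) (mut_seq w s) = s"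
proof (induction w arbitrary: s)
  case (Cons k w)
  then show ?case using Cons.IH[OF labeled_seed_mut] by (simp add: mut_involution)
qed simp

section \<open>Relabeling\<close>

lemma perm_seed_perm_seed [simp]: "perm_seed \<sigma> (perm_seed \<tau> s) = perm_seed (\<tau> \<circ> \<sigma>) s"
  by (simp add: perm_seed_def perm_matrix_def comp_assoc)

lemma perm_seed_id [simp]: "perm_seed id s = s"
  by (simp add: perm_seed_def perm_matrix_def)

lemma perm_seed_Pair: "perm_seed \<sigma> (x, B) = (x \<circ> \<sigma>, perm_matrix \<sigma> B)"
  by (simp add: perm_seed_def)

text \<open>
  The inverse permutation. The name \<open>inv\<close> is that of the inverse in a group.
\<close>

abbreviation pinv :: "('n \<Rightarrow> 'n) \<Rightarrow> 'n \<Rightarrow> 'n" where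
  "pinv \<sigma> \<equiv> inv_into UNIV \<sigma>"

lemma bij_pinv_o [simp]: "bij \<sigma> \<Longrightarrow> \<sigma> \<circ> pinv \<sigma> = id" "bij \<sigma> \<Longrightarrow> pinv \<sigma> \<circ> \<sigma> = id"
  by (auto simp: bij_def surj_iff inj_iff)

lemma mut_perm_seed:
  fixes s :: "('n::finite, 'f::field_char_0) lseed"
  assumes "bij \<sigma>"
  shows "mut k (perm_seed \<sigma> s) = perm_seed \<sigma> (mut (\<sigma> k) s)"
proof -
  obtain x B where s: "s = (x, B)" by (cases s)
  have eq: "\<sigma> i = \<sigma> j \<longleftrightarrow> i = j" for i j using assms by (auto simp: bij_def inj_eq)
  have "(\<Prod>i\<in>UNIV. x (\<sigma> i) ^ nat (c (\<sigma> i))) = (\<Prod>i\<in>UNIV. x i ^ nat (c i))" for c :: "'n \<Rightarrow> int"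
    using assms by (rule prod.reindex_bij_betw)
  from this[of "\<lambda>i. B i (\<sigma> k)"] this[of "\<lambda>i. - B i (\<sigma> k)"]
  have "mut_var k (perm_seed \<sigma> s) = mut_var (\<sigma> k) s"
    by (simp add: mut_var_def s perm_seed_Pair perm_matrix_def)
  then show ?thesis
    by (auto simp: mut_def perm_seed_def perm_matrix_def mut_matrix_def fun_eq_iff eq)
qed

lemma mut_seq_perm_seed:
  "bij \<sigma> \<Longrightarrow> mut_seq w (perm_seed \<sigma> s) = perm_seed \<sigma> (mut_seq (map \<sigma> w) s)"
  by (induction w arbitrary: s) (simp_all add: mut_perm_seed)

lemma perm_seed_mut_seq:
  assumes "bij \<sigma>"
  shows "perm_seed \<sigma> (mut_seq w s) = mut_seq (map (pinv \<sigma>) w) (perm_seed \<sigma> s)"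
  using assms by (simp add: mut_seq_perm_seed)

lemma mut_matrix_seq_perm_matrix:
  fixes B :: "'n::finite \<Rightarrow> 'n \<Rightarrow> int"
  assumes "bij \<sigma>"
  shows "mut_matrix_seq w (perm_matrix \<sigma> B) = perm_matrix \<sigma> (mut_matrix_seq (map \<sigma> w) B)"
  using arg_cong[OF mut_seq_perm_seed[OF assms, of w "(undefined :: _ \<Rightarrow> rat, B)"], of snd]
  by (simp add: perm_seed_def)

lemma labeled_seed_perm_seed:
  fixes s :: "('n::finite, 'f::field_char_0) lseed"
  assumes "labeled_seed s" "bij \<sigma>"
  shows "labeled_seed (perm_seed \<sigma> s)"
proof -
  obtain x B where s: "s = (x, B)" by (cases s)
  note x = labeled_seedD[OF assms(1), unfolded s fst_conv snd_conv]
  have inv: "\<sigma> (pinv \<sigma> i) = i" "pinv \<sigma> (\<sigma> i) = i" for i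
    using assms(2) by (simp_all add: bij_is_surj surj_f_inv_f bij_is_inj)
  have "free_generators (x \<circ> \<sigma>)"
  proof (rule free_generators_transfer[OF x(1)])
    show "specializes x (x \<circ> pinv \<sigma>) ((x \<circ> \<sigma>) i) (x i)" for i
      using specializes_var[of x "x \<circ> pinv \<sigma>" "\<sigma> i"] by (simp add: inv)
    show "ratfun (x \<circ> \<sigma>) (x i)" for i
      using specializes_var[of "x \<circ> \<sigma>" "x \<circ> \<sigma>" "pinv \<sigma> i"]
      by (simp add: inv ratfun_iff_specializes)
  qed
  moreover obtain d where "symmetrizer d B" using x(4) by (auto simp: skew_symmetrizable_iff)
  then have "symmetrizer (d \<circ> \<sigma>) (perm_matrix \<sigma> B)"
    unfolding symmetrizer_def perm_matrix_def comp_def by blast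
  moreover have "(\<lambda>a b. B (\<sigma> a) (\<sigma> b) \<noteq> 0)\<^sup>*\<^sup>* (pinv \<sigma> i) (pinv \<sigma> j)"
    if "(\<lambda>a b. B a b \<noteq> 0)\<^sup>*\<^sup>* i j" for i j
    using that by induction (auto intro: rtranclp.rtrancl_into_rtrancl simp: inv)
  then have "indecomposable (perm_matrix \<sigma> B)"
    using x(5) unfolding indecomposable_def perm_matrix_def by (metis inv(2))
  ultimately show ?thesis
    by (auto simp: labeled_seed_def s perm_seed_Pair skew_symmetrizable_iff)
qed


section \<open>The seeds of a cluster algebra\<close>

lemma seeds_iff: "t \<in> seeds s \<longleftrightarrow> (\<exists>\<sigma> w. bij \<sigma> \<and> t = perm_seed \<sigma> (mut_seq w s))"
  unfolding seeds_def mut_class_def by blast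

lemma mut_seq_in_seeds [simp]: "mut_seq w s \<in> seeds s"
  unfolding seeds_iff by (intro exI[of _ id] exI[of _ w]) simp

lemma seed_in_seeds [simp]: "s \<in> seeds s"
  using mut_seq_in_seeds[of "[]"] by simp

lemma perm_seed_in_seeds: "t \<in> seeds s \<Longrightarrow> bij \<sigma> \<Longrightarrow> perm_seed \<sigma> t \<in> seeds s"
  unfolding seeds_iff by (metis bij_comp perm_seed_perm_seed)

lemma seeds_trans:
  assumes "t \<in> seeds s" "u \<in> seeds t"
  shows "u \<in> seeds s"
proof -
  obtain \<sigma> \<tau> v w where "bij \<sigma>" "bij \<tau>"
    and "t = perm_seed \<sigma> (mut_seq v s)" "u = perm_seed \<tau> (mut_seq w t)"
    using assms unfolding seeds_iff by blast
  then have "u = perm_seed (\<sigma> \<circ> \<tau>) (mut_seq (v @ map \<sigma> w) s)"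
    by (simp add: mut_seq_perm_seed)
  then show ?thesis
    using bij_comp[OF \<open>bij \<tau>\<close> \<open>bij \<sigma>\<close>] unfolding seeds_iff by blast
qed

lemma seeds_sym:
  assumes "labeled_seed s" "t \<in> seeds s"
  shows "s \<in> seeds t"
proof -
  obtain \<sigma> w where \<sigma>: "bij \<sigma>" "t = perm_seed \<sigma> (mut_seq w s)"
    using assms(2) unfolding seeds_iff by blast
  have "perm_seed (pinv \<sigma>) t \<in> seeds t"
    using \<sigma>(1) by (intro perm_seed_in_seeds) (simp_all add: bij_imp_bij_inv)
  then have "mut_seq (rev w) (perm_seed (pinv \<sigma>) t) \<in> seeds t"
    by (rule seeds_trans) (rule mut_seq_in_seeds)
  also have "mut_seq (rev w) (perm_seed (pinv \<sigma>) t) = s"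
    using \<sigma> assms(1) by simp
  finally show ?thesis .
qed

lemma seeds_eq:
  assumes "labeled_seed s" "t \<in> seeds s"
  shows "seeds t = seeds s"
proof (intro equalityI subsetI)
  show "u \<in> seeds s" if "u \<in> seeds t" for u using seeds_trans[OF assms(2) that] .
  show "u \<in> seeds t" if "u \<in> seeds s" for u
    using seeds_trans[OF seeds_sym[OF assms] that] .
qed

lemma labeled_seed_seeds:
  assumes "labeled_seed s" "t \<in> seeds s"
  shows "labeled_seed t"
proof -
  obtain \<sigma> w where "bij \<sigma>" "t = perm_seed \<sigma> (mut_seq w s)"
    using assms(2) unfolding seeds_iff by blast
  then show ?thesis
    using labeled_seed_perm_seed[OF labeled_seed_mut_seq[OF assms(1)]] by blast
qed

lemma mut_seq_in_seeds':
  assumes "t \<in> seeds s"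
  shows "mut_seq w t \<in> seeds s"
  by (rule seeds_trans[OF assms mut_seq_in_seeds])

lemma mut_in_seeds:
  assumes "t \<in> seeds s"
  shows "mut k t \<in> seeds s"
  using mut_seq_in_seeds'[OF assms, of "[k]"] by (simp only: mut_seq_simps)


section \<open>The exchange polynomials determine the matrix up to sign\<close>

text \<open>
  The exchange polynomial is the sum of the monomials belonging to the positive and to the negative
  part of the column. As \<open>x\<close> is algebraically independent, the unordered pair of these monomials is
  determined, hence the column up to exchanging its positive and its negative part.
\<close>

lemma exchange_column_unique:
  fixes x :: "'n::finite \<Rightarrow> 'f::field_char_0"
  assumes x: "alg_independent x" and eq: "mut_var k (x, B) = mut_var k (x, C)"
  shows "(\<forall>i. C i k = B i k) \<or> (\<forall>i. C i k = - B i k)"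
proof -
  define m where "m c = Abs_poly_mapping (\<lambda>i. nat (c i))" for c :: "'n \<Rightarrow> int"
  have lookup_m: "Poly_Mapping.lookup (m c) i = nat (c i)" for c i
    by (simp add: m_def)
  have m_eq: "m b = m c \<longleftrightarrow> (\<forall>i. nat (b i) = nat (c i))" for b c
    by (simp add: poly_mapping_eq_iff lookup_m fun_eq_iff)
  define p :: "('n \<Rightarrow> int) \<Rightarrow> ('n \<Rightarrow>\<^sub>0 nat) \<Rightarrow>\<^sub>0 rat" where
    "p b = Poly_Mapping.single (m b) 1 + Poly_Mapping.single (m (\<lambda>i. - b i)) 1" for b
  have "mut_var k (x, B) = poly_eval x (p (\<lambda>i. B i k)) / x k" for B
    by (simp add: mut_var_def p_def poly_eval_add poly_eval_single lookup_m)
  then have "poly_eval x (p (\<lambda>i. B i k)) = poly_eval x (p (\<lambda>i. C i k))"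
    using eq alg_independent_nonzero[OF x, of k] by simp
  then have "p (\<lambda>i. B i k) = p (\<lambda>i. C i k)"
    by (rule alg_independent_inj[OF x])
  then have "Poly_Mapping.lookup (p (\<lambda>i. B i k)) n = Poly_Mapping.lookup (p (\<lambda>i. C i k)) n" for n
    by simp
  then have *: "(1 when m (\<lambda>i. B i k) = n) + (1 when m (\<lambda>i. - B i k) = n) =
      (1 when m (\<lambda>i. C i k) = n) + ((1::rat) when m (\<lambda>i. - C i k) = n)" for n
    by (simp add: p_def lookup_add lookup_single)
  have cases: "m (\<lambda>i. B i k) = m (\<lambda>i. C i k) \<and> m (\<lambda>i. - B i k) = m (\<lambda>i. - C i k) \<or>
      m (\<lambda>i. B i k) = m (\<lambda>i. - C i k) \<and> m (\<lambda>i. - B i k) = m (\<lambda>i. C i k)"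
    using *[of "m (\<lambda>i. B i k)"] *[of "m (\<lambda>i. - B i k)"]
      *[of "m (\<lambda>i. C i k)"] *[of "m (\<lambda>i. - C i k)"]
    by (auto simp: when_def split: if_splits)
  have nat_eq: "a = b" if "nat a = nat b \<and> nat (- a) = nat (- b)" for a b :: int
    using that by linarith
  from cases show ?thesis
  proof (elim disjE conjE)
    assume "m (\<lambda>i. B i k) = m (\<lambda>i. C i k)" "m (\<lambda>i. - B i k) = m (\<lambda>i. - C i k)"
    then have "nat (B i k) = nat (C i k) \<and> nat (- B i k) = nat (- C i k)" for i
      by (auto simp: m_eq)
    then have "C i k = B i k" for i using nat_eq by metis
    then show ?thesis by blast
  next
    assume "m (\<lambda>i. B i k) = m (\<lambda>i. - C i k)" "m (\<lambda>i. - B i k) = m (\<lambda>i. C i k)"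
    then have "nat (B i k) = nat (- C i k) \<and> nat (- B i k) = nat (- (- C i k))" for i
      by (auto simp: m_eq)
    then have "C i k = - B i k" for i using nat_eq by (metis minus_minus)
    then show ?thesis by blast
  qed
qed

text \<open>
  Signs of different columns are linked by skew-symmetrizability: \<open>b\<^sub>i\<^sub>j\<close> lies in column \<open>j\<close>,
  \<open>b\<^sub>j\<^sub>i\<close> in column \<open>i\<close>, and their signs are opposite in both matrices. So the sign is the same at the
  two ends of an edge, and it spreads over the whole index set.
\<close>

lemma columns_unique_imp_sign:
  assumes "skew_symmetrizable B" "skew_symmetrizable C" "indecomposable B"
    and col: "\<And>k. (\<forall>i. C i k = B i k) \<or> (\<forall>i. C i k = - B i k)"
  shows "C = B \<or> C = (\<lambda>i j. - B i j)"
proof -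
  have step: "\<forall>i. C i b = \<epsilon> * B i b"
    if "\<forall>i. C i a = \<epsilon> * B i a" "B a b \<noteq> 0" for a b and \<epsilon> :: int
  proof -
    obtain \<delta> :: int where \<delta>: "\<delta> = 1 \<or> \<delta> = -1" "\<forall>i. C i b = \<delta> * B i b"
      using col[of b] by (metis mult_1 mult_minus1)
    have swap: "sgn (B b a) = - sgn (B a b)" "sgn (C b a) = - sgn (C a b)"
      using assms(1,2) symmetrizer_sgn unfolding skew_symmetrizable_iff by metis+
    have "sgn \<epsilon> * sgn (B b a) = sgn (C b a)" using that(1) by (simp add: sgn_mult)
    also have "\<dots> = - sgn (\<delta> * B a b)" using swap \<delta>(2) by simp
    also have "\<dots> = \<delta> * sgn (B b a)" using swap \<delta>(1) by (auto simp: sgn_mult)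
    finally have "sgn \<epsilon> = \<delta>" using swap that(2) by (auto simp: sgn_0_0)
    moreover have "\<bar>\<epsilon>\<bar> = 1"
    proof -
      have "B b a \<noteq> 0" using swap(1) that(2) by (metis neg_equal_0_iff_equal sgn_0_0 sgn_0)
      moreover have "\<bar>C b a\<bar> = \<bar>B b a\<bar>" using col[of a] by (metis abs_minus_cancel)
      ultimately show ?thesis using that(1) by (auto simp: abs_mult)
    qed
    ultimately have "\<epsilon> = \<delta>" by (auto simp: sgn_if abs_if split: if_splits)
    then show ?thesis using \<delta>(2) by simp
  qed
  obtain \<epsilon> :: int where \<epsilon>: "\<epsilon> = 1 \<or> \<epsilon> = -1" "\<forall>i. C i undefined = \<epsilon> * B i undefined"
    using col[of undefined] by (metis mult_1 mult_minus1)
  have "\<forall>i. C i b = \<epsilon> * B i b" if "(\<lambda>a b. B a b \<noteq> 0)\<^sup>*\<^sup>* undefined b" for b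
    using that by induction (use \<epsilon> step in blast)+
  then have "C i b = \<epsilon> * B i b" for i b
    using assms(3) unfolding indecomposable_def by blast
  then show ?thesis using \<epsilon>(1) by (auto simp: fun_eq_iff)
qed


section \<open>The mutation-invariant two-form\<close>

text \<open>
  The value on a pair of tangent vectors of \<open>\<Sum>\<^sub>i\<^sub>j b\<^sub>i\<^sub>j e\<^sub>j dlog x\<^sub>i \<otimes> dlog x\<^sub>j\<close>, where the coordinates
  of a tangent vector are the logarithmic derivatives of the \<open>x\<^sub>i\<close>. The matrix \<open>(b\<^sub>i\<^sub>j e\<^sub>j)\<close> is
  skew-symmetric for \<open>e\<^sub>j = 1/d\<^sub>j\<close>. The weights multiply columns because the exchange relation at \<open>k\<close>
  has the entries of the \<open>k\<close>-th column as exponents: the logarithm of the quotient of its two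
  monomials must be proportional to the contraction of the form with \<open>\<partial>/\<partial> log x\<^sub>k\<close>.
\<close>

definition two_form ::
  "('n::finite \<Rightarrow> real) \<Rightarrow> ('n \<Rightarrow> 'n \<Rightarrow> int) \<Rightarrow> ('n \<Rightarrow> real) \<Rightarrow> ('n \<Rightarrow> real) \<Rightarrow> real" where
  "two_form e B u v = (\<Sum>i\<in>UNIV. \<Sum>j\<in>UNIV. of_int (B i j) * e j * u i * v j)"

text \<open>
  The differential of a mutation in logarithmic coordinates. If \<open>P\<close> and \<open>Q\<close> are the monomials of the
  exchange relation, then \<open>dlog (P + Q) = \<theta> dlog P + (1 - \<theta>) dlog Q\<close> with \<open>\<theta> = P / (P + Q)\<close>.
\<close>

definition tangent_mut ::
  "real \<Rightarrow> 'n::finite \<Rightarrow> ('n \<Rightarrow> 'n \<Rightarrow> int) \<Rightarrow> ('n \<Rightarrow> real) \<Rightarrow> ('n \<Rightarrow> real)" where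
  "tangent_mut \<theta> k B u = u(k := \<theta> * (\<Sum>i\<in>UNIV. real (nat (B i k)) * u i) +
     (1 - \<theta>) * (\<Sum>i\<in>UNIV. real (nat (- B i k)) * u i) - u k)"

text \<open>
  The matrix identity behind the invariance. Changing \<open>\<theta>\<close> changes \<open>c\<close> by a multiple of the column
  \<open>(b\<^sub>i\<^sub>k)\<^sub>i\<close>, and \<open>\<beta>\<^sub>i = b\<^sub>i\<^sub>k e\<^sub>k\<close> is a multiple of that column too. Hence \<open>c\<^sub>i \<beta>\<^sub>j - \<beta>\<^sub>i c\<^sub>j\<close> is independent
  of \<open>\<theta>\<close>, and what remains is the mutation rule.
\<close>

lemma two_form_coefficient:
  fixes B :: "'n::finite \<Rightarrow> 'n \<Rightarrow> int" and e :: "'n \<Rightarrow> real" and \<theta> :: real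
  assumes e: "\<And>i. e i > 0" and skew: "\<And>i j. of_int (B i j) * e j = - (of_int (B j i) * e i)"
    and ne: "i \<noteq> k" "j \<noteq> k"
  defines "c \<equiv> \<lambda>i. \<theta> * real (nat (B i k)) + (1 - \<theta>) * real (nat (- B i k))"
  shows "of_int (mut_matrix k B i j) * e j + c i * (of_int (B j k) * e k)
           - (of_int (B i k) * e k) * c j = of_int (B i j) * e j"
proof -
  define a b where "a = real_of_int (B i k)" and "b = real_of_int (B k j)"
  have nat: "real (nat z) = max (real_of_int z) 0" for z by (simp add: max_def)
  have scale: "max y 0 * x = max (y * x) 0" if "x > 0" for x y :: real
    using that by (simp add: max_def mult_le_0_iff not_le)
  have \<beta>: "of_int (B j k) * e k = - b * e j" using skew[of j k] by (simp add: b_def)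
  have pos: "max (of_int (B j k)) 0 * e k = max (- b) 0 * e j"
    unfolding scale[OF e] \<beta> ..
  have neg: "max (- of_int (B j k)) 0 * e k = max b 0 * e j"
    unfolding scale[OF e] mult_minus_left \<beta> by simp
  have "c j * e k = \<theta> * (max (of_int (B j k)) 0 * e k) + (1 - \<theta>) * (max (- of_int (B j k)) 0 * e k)"
    unfolding c_def nat by (simp add: algebra_simps)
  then have cj: "e k * c j = e j * (\<theta> * max (- b) 0 + (1 - \<theta>) * max b 0)"
    unfolding pos neg by (simp add: algebra_simps)
  have ci: "c i = \<theta> * max a 0 + (1 - \<theta>) * max (- a) 0"
    by (simp add: c_def nat a_def)
  have "real_of_int (sgn (B i k) * max (B i k * B k j) 0) =
      max a 0 * max b 0 - max (- a) 0 * max (- b) 0"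
    unfolding sgn_mult_max a_def b_def by (simp add: of_int_max)
  then have B': "real_of_int (mut_matrix k B i j) =
      of_int (B i j) + (max a 0 * max b 0 - max (- a) 0 * max (- b) 0)"
    using ne by (simp add: mut_matrix_def)
  define ap am bp bm where "ap = max a 0" and "am = max (- a) 0"
    and "bp = max b 0" and "bm = max (- b) 0"
  have parts: "a = ap - am" "b = bp - bm" by (simp_all add: ap_def am_def bp_def bm_def)
  have "a * (e k * c j) = e j * (a * (\<theta> * bm + (1 - \<theta>) * bp))"
    unfolding cj bp_def bm_def by simp
  also have "\<dots> = e j * (ap * bp - am * bm - (\<theta> * ap + (1 - \<theta>) * am) * b)"
    unfolding parts by (simp add: algebra_simps)
  also have "\<dots> = e j * (of_int (mut_matrix k B i j) - of_int (B i j) - c i * b)"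
    unfolding B' ci ap_def am_def bp_def bm_def by simp
  finally show ?thesis
    unfolding \<beta> a_def by (simp add: algebra_simps)
qed

text \<open>
  With \<open>\<epsilon>\<close> the sign change of the \<open>k\<close>-th coordinate and \<open>c\<close> the logarithmic gradient of the
  exchange polynomial, the new \<open>k\<close>-th coordinate is \<open>\<epsilon>\<^sub>k u\<^sub>k + \<Sum>\<^sub>i c\<^sub>i u\<^sub>i\<close>. Expanding the form of the
  mutated matrix \<open>W'\<close> gives \<open>W'\<^sub>i\<^sub>j \<epsilon>\<^sub>i \<epsilon>\<^sub>j + c\<^sub>i \<beta>\<^sub>j - \<beta>\<^sub>i c\<^sub>j\<close> as the coefficient of \<open>u\<^sub>i v\<^sub>j\<close>, where
  \<open>\<beta>\<close> is the weighted \<open>k\<close>-th column.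
\<close>

lemma two_form_mut:
  fixes B :: "'n::finite \<Rightarrow> 'n \<Rightarrow> int" and e :: "'n \<Rightarrow> real"
  assumes e: "\<And>i. e i > 0" and skew: "\<And>i j. of_int (B i j) * e j = - (of_int (B j i) * e i)"
  shows "two_form e (mut_matrix k B) (tangent_mut \<theta> k B u) (tangent_mut \<theta> k B v) = two_form e B u v"
proof -
  define c where "c = (\<lambda>i. \<theta> * real (nat (B i k)) + (1 - \<theta>) * real (nat (- B i k)))"
  define \<epsilon> where "\<epsilon> = (\<lambda>i. if i = k then - 1 else 1 :: real)"
  define \<beta> where "\<beta> = (\<lambda>i. of_int (B i k) * e k)"
  define C where "C = (\<lambda>u. \<Sum>i\<in>UNIV. c i * u i :: real)"
  define W' where "W' = (\<lambda>i j. of_int (mut_matrix k B i j) * e j)"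
  have Bkk: "B k k = 0" using skew[of k k] e[of k] by simp
  have tangent: "tangent_mut \<theta> k B u i = \<epsilon> i * u i + (if i = k then C u else 0)" for u i
    by (simp add: tangent_mut_def \<epsilon>_def C_def c_def distrib_right sum.distrib sum_distrib_left mult.assoc)
  have row: "W' k j * \<epsilon> j = \<beta> j" and column: "W' i k * \<epsilon> i = - \<beta> i" and diag: "W' k k = 0" for i j
    using skew[of k j] Bkk by (auto simp: W'_def \<epsilon>_def \<beta>_def mut_matrix_def)
  have "two_form e (mut_matrix k B) (tangent_mut \<theta> k B u) (tangent_mut \<theta> k B v) =
      (\<Sum>i\<in>UNIV. \<Sum>j\<in>UNIV. W' i j * (\<epsilon> i * u i + (if i = k then C u else 0)) *
        (\<epsilon> j * v j + (if j = k then C v else 0)))"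
    unfolding two_form_def tangent W'_def by (simp add: mult_ac)
  also have "\<dots> = (\<Sum>i\<in>UNIV. \<Sum>j\<in>UNIV. W' i j * \<epsilon> i * \<epsilon> j * u i * v j)
      + (\<Sum>i\<in>UNIV. if i = k then (\<Sum>j\<in>UNIV. (W' i j * \<epsilon> j) * v j * C u) else 0)
      + (\<Sum>i\<in>UNIV. \<Sum>j\<in>UNIV. if j = k then (W' i j * \<epsilon> i) * u i * C v else 0)
      + (\<Sum>i\<in>UNIV. \<Sum>j\<in>UNIV. if j = k then (if i = k then W' i j * C u * C v else 0) else 0)"
  proof -
    have "W' i j * (\<epsilon> i * u i + (if i = k then C u else 0)) * (\<epsilon> j * v j + (if j = k then C v else 0)) =
      W' i j * \<epsilon> i * \<epsilon> j * u i * v j + (if i = k then (W' i j * \<epsilon> j) * v j * C u else 0)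
      + (if j = k then (W' i j * \<epsilon> i) * u i * C v else 0)
      + (if j = k then (if i = k then W' i j * C u * C v else 0) else 0)" for i j
      by (auto simp: algebra_simps)
    moreover have "(if i = k then (\<Sum>j\<in>UNIV. (W' i j * \<epsilon> j) * v j * C u) else 0) =
      (\<Sum>j\<in>UNIV. if i = k then (W' i j * \<epsilon> j) * v j * C u else 0)" for i
      by simp
    ultimately show ?thesis by (simp only: sum.distrib)
  qed
  also have "\<dots> = (\<Sum>i\<in>UNIV. \<Sum>j\<in>UNIV. W' i j * \<epsilon> i * \<epsilon> j * u i * v j)
      + (\<Sum>j\<in>UNIV. \<beta> j * v j) * C u - (\<Sum>i\<in>UNIV. \<beta> i * u i) * C v"
    by (simp add: sum.delta row column diag sum_distrib_right sum_negf)
  also have "\<dots> = (\<Sum>i\<in>UNIV. \<Sum>j\<in>UNIV. (W' i j * \<epsilon> i * \<epsilon> j + c i * \<beta> j - \<beta> i * c j) * u i * v j)"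
  proof -
    have "(\<Sum>j\<in>UNIV. \<beta> j * v j) * C u = (\<Sum>i\<in>UNIV. \<Sum>j\<in>UNIV. c i * \<beta> j * u i * v j)"
      unfolding C_def by (subst mult.commute, subst sum_product) (simp add: mult_ac)
    moreover have "(\<Sum>i\<in>UNIV. \<beta> i * u i) * C v = (\<Sum>i\<in>UNIV. \<Sum>j\<in>UNIV. \<beta> i * c j * u i * v j)"
      unfolding C_def by (simp add: sum_product mult_ac)
    ultimately show ?thesis
      by (simp add: sum.distrib sum_subtractf left_diff_distrib distrib_right)
  qed
  also have "\<dots> = (\<Sum>i\<in>UNIV. \<Sum>j\<in>UNIV. of_int (B i j) * e j * u i * v j)"
  proof -
    have "W' i j * \<epsilon> i * \<epsilon> j + c i * \<beta> j - \<beta> i * c j = of_int (B i j) * e j" for i j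
    proof (cases "i = k \<or> j = k")
      case True
      then show ?thesis
        using Bkk by (auto simp: W'_def \<epsilon>_def \<beta>_def c_def mut_matrix_def)
    next
      case False
      then show ?thesis
        using two_form_coefficient[OF e skew, where i = i and j = j and k = k and \<theta> = \<theta>]
        by (simp add: W'_def \<epsilon>_def \<beta>_def c_def)
    qed
    then show ?thesis by simp
  qed
  finally show ?thesis by (simp add: two_form_def)
qed


section \<open>Logarithmic derivatives along a mutation sequence\<close>

lemma log_derivative_monomial:
  fixes y :: "real \<Rightarrow> 'n \<Rightarrow> real"
  assumes "\<And>i. ((\<lambda>t. y t i) has_real_derivative y 0 i * u i) (at 0)"
  shows "((\<lambda>t. \<Prod>i\<in>I. y t i ^ n i) has_real_derivative
           (\<Prod>i\<in>I. y 0 i ^ n i) * (\<Sum>i\<in>I. real (n i) * u i)) (at 0)"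
proof (induction I rule: infinite_finite_induct)
  case (insert i I)
  have "((\<lambda>t. y t i ^ n i) has_real_derivative y 0 i ^ n i * (real (n i) * u i)) (at 0)"
    using DERIV_power[OF assms[of i], of "n i"]
    by (cases "n i") (simp_all add: algebra_simps)
  from DERIV_mult[OF this insert.IH] show ?case
    using insert.hyps by (simp add: algebra_simps)
qed simp_all

lemma log_derivative_mut_var:
  fixes y :: "real \<Rightarrow> 'n::finite \<Rightarrow> real" and B :: "'n \<Rightarrow> 'n \<Rightarrow> int" and k :: 'n
  assumes pos: "\<And>i. y 0 i > 0"
    and der: "\<And>i. ((\<lambda>t. y t i) has_real_derivative y 0 i * u i) (at 0)"
  defines "M \<equiv> \<lambda>c. \<Prod>i\<in>UNIV. y 0 i ^ nat (c i)"
  defines "\<theta> \<equiv> M (\<lambda>i. B i k) / (M (\<lambda>i. B i k) + M (\<lambda>i. - B i k))"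
  shows "((\<lambda>t. mut_var k (y t, B)) has_real_derivative
           mut_var k (y 0, B) * tangent_mut \<theta> k B u k) (at 0)"
proof -
  have M: "M c > 0" for c unfolding M_def using pos by (simp add: prod_pos)
  let ?P = "M (\<lambda>i. B i k)" and ?Q = "M (\<lambda>i. - B i k)"
  let ?p = "\<Sum>i\<in>UNIV. real (nat (B i k)) * u i" and ?q = "\<Sum>i\<in>UNIV. real (nat (- B i k)) * u i"
  have "?P + ?Q > 0" using M add_pos_pos by blast
  have "((\<lambda>t. mut_var k (y t, B)) has_real_derivative
      ((?P * ?p + ?Q * ?q) * y 0 k - (?P + ?Q) * (y 0 k * u k)) / (y 0 k * y 0 k)) (at 0)"
    unfolding mut_var_def prod.case M_def
    by (intro DERIV_divide DERIV_add log_derivative_monomial der)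
      (use pos[of k] in auto)
  also have "((?P * ?p + ?Q * ?q) * y 0 k - (?P + ?Q) * (y 0 k * u k)) / (y 0 k * y 0 k) =
      ((?P * ?p + ?Q * ?q) - (?P + ?Q) * u k) / y 0 k"
    using pos[of k] by (simp add: field_simps)
  also have "\<dots> = (?P + ?Q) / y 0 k * tangent_mut \<theta> k B u k"
  proof -
    have "1 - \<theta> = ?Q / (?P + ?Q)"
      unfolding \<theta>_def using \<open>?P + ?Q > 0\<close> by (simp add: field_simps)
    then have "(?P + ?Q) * tangent_mut \<theta> k B u k = ?P * ?p + ?Q * ?q - (?P + ?Q) * u k"
      using \<open>?P + ?Q > 0\<close> unfolding tangent_mut_def \<theta>_def fun_upd_same
      by (simp add: right_diff_distrib distrib_left)
    then show ?thesis by (simp add: mult.commute)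
  qed
  also have "(?P + ?Q) / y 0 k = mut_var k (y 0, B)"
    by (simp add: mut_var_def M_def)
  finally show ?thesis .
qed

lemma mut_var_pos:
  fixes b :: "'n::finite \<Rightarrow> real"
  shows "(\<And>i. b i > 0) \<Longrightarrow> mut_var k (b, B) > 0"
  by (simp add: mut_var_def prod_pos add_pos_pos)

text \<open>
  The derivatives are taken at a common point \<open>a\<close> of the curves \<open>y\<close> and \<open>z\<close>, so both directions see the
  same value of \<open>\<theta>\<close> at every mutation. Positivity keeps all variables nonzero along the sequence.
\<close>

lemma two_form_mut_seq:
  fixes y z :: "real \<Rightarrow> 'n::finite \<Rightarrow> real"
  assumes "symmetrizer d B" "\<And>i. a i > 0" "y 0 = a" "z 0 = a"
    and "\<And>i. ((\<lambda>t. y t i) has_real_derivative a i * u i) (at 0)"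
    and "\<And>i. ((\<lambda>t. z t i) has_real_derivative a i * v i) (at 0)"
  shows "\<exists>u' v'.
      (\<forall>i. ((\<lambda>t. fst (mut_seq w (y t, B)) i) has_real_derivative
        fst (mut_seq w (a, B)) i * u' i) (at 0)) \<and>
      (\<forall>i. ((\<lambda>t. fst (mut_seq w (z t, B)) i) has_real_derivative
        fst (mut_seq w (a, B)) i * v' i) (at 0)) \<and>
      two_form (\<lambda>i. 1 / d i) (mut_matrix_seq w B) u' v' = two_form (\<lambda>i. 1 / d i) B u v"
  using assms
proof (induction w arbitrary: B a y z u v)
  case Nil
  then show ?case by auto
next
  case (Cons k w)
  note sym = Cons.prems(1) and a = Cons.prems(2) and y0 = Cons.prems(3) and z0 = Cons.prems(4)
  have d: "d i > 0" "d i * B i j = - (d j * B j i)" for i j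
    using sym unfolding symmetrizer_def by blast+
  have skew: "of_int (B i j) * (1 / d j) = - (of_int (B j i) * (1 / real_of_int (d i)))" for i j
  proof -
    have "real_of_int (d i) * of_int (B i j) = - (real_of_int (d j) * of_int (B j i))"
      using arg_cong[OF d(2)[of i j], of real_of_int] by simp
    then show ?thesis using d(1)[of i] d(1)[of j] by (simp add: field_simps)
  qed
  define \<theta> where "\<theta> = (\<Prod>i\<in>UNIV. a i ^ nat (B i k)) /
    ((\<Prod>i\<in>UNIV. a i ^ nat (B i k)) + (\<Prod>i\<in>UNIV. a i ^ nat (- B i k)))"
  define mu1 where "mu1 = (\<lambda>b :: 'n \<Rightarrow> real. b(k := mut_var k (b, B)))"
  have mut: "mut k (b, B) = (mu1 b, mut_matrix k B)" for b
    by (simp add: mut_def mu1_def)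
  have der: "((\<lambda>t. mu1 (f t) i) has_real_derivative mu1 a i * tangent_mut \<theta> k B g i) (at 0)"
    if "f 0 = a" "\<And>i. ((\<lambda>t. f t i) has_real_derivative a i * g i) (at 0)" for f g i
  proof (cases "i = k")
    case True
    then show ?thesis
      using log_derivative_mut_var[of f g k B] that a by (simp add: mu1_def \<theta>_def)
  next
    case False
    then show ?thesis using that(2)[of i] by (simp add: mu1_def tangent_mut_def)
  qed
  have "mu1 a i > 0" for i using a mut_var_pos[of a k B] by (simp add: mu1_def)
  moreover have "mu1 (y 0) = mu1 a" "mu1 (z 0) = mu1 a" using y0 z0 by simp_all
  ultimately obtain u' v' where "(\<forall>i. ((\<lambda>t. fst (mut_seq w (mu1 (y t), mut_matrix k B)) i) has_real_derivative
        fst (mut_seq w (mu1 a, mut_matrix k B)) i * u' i) (at 0)) \<and>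
      (\<forall>i. ((\<lambda>t. fst (mut_seq w (mu1 (z t), mut_matrix k B)) i) has_real_derivative
        fst (mut_seq w (mu1 a, mut_matrix k B)) i * v' i) (at 0)) \<and>
      two_form (\<lambda>i. 1 / d i) (mut_matrix_seq w (mut_matrix k B)) u' v' =
      two_form (\<lambda>i. 1 / d i) (mut_matrix k B) (tangent_mut \<theta> k B u) (tangent_mut \<theta> k B v)"
    using Cons.IH[OF symmetrizer_mut_matrix[OF sym, of k], where a = "mu1 a"
        and y = "\<lambda>t. mu1 (y t)" and z = "\<lambda>t. mu1 (z t)"
        and u = "tangent_mut \<theta> k B u" and v = "tangent_mut \<theta> k B v"]
      der[OF y0 Cons.prems(5)] der[OF z0 Cons.prems(6)] by blast
  moreover have "two_form (\<lambda>i. 1 / d i) (mut_matrix k B) (tangent_mut \<theta> k B u) (tangent_mut \<theta> k B v) =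
      two_form (\<lambda>i. 1 / d i) B u v"
  proof (rule two_form_mut)
    show "1 / real_of_int (d i) > 0" for i using d(1)[of i] by simp
  qed (rule skew)
  ultimately show ?case unfolding mut_seq_simps mut_matrix_seq_simps mut by metis
qed


section \<open>A seed is not equivalent to its opposite\<close>

text \<open>
  Mutation only adds, multiplies and divides, so that positive real values stay positive and no
  denominator vanishes on the way.
\<close>

lemma specializes_mut_seq:
  fixes x :: "'m::finite \<Rightarrow> 'f::field_char_0" and y :: "'n::finite \<Rightarrow> 'f" and b :: "'n \<Rightarrow> real"
  assumes x: "alg_independent x" and "\<And>i. specializes x a (y i) (b i)" "\<And>i. b i > 0"
  shows "specializes x a (fst (mut_seq w (y, B)) i) (fst (mut_seq w (b, B)) i)"
  using assms(2,3)
proof (induction w arbitrary: y b B)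
  case (Cons k w)
  have "specializes x a (mut_var k (y, B)) (mut_var k (b, B))"
    using Cons.prems(2)[of k] by (intro specializes_mut_var x Cons.prems) simp
  then show ?case
    using Cons.prems mut_var_pos[of b k B]
    by (auto simp: mut_def intro!: Cons.IH)
qed simp

text \<open>
  Both \<open>d\<close> and \<open>d \<circ> \<tau>\<close> symmetrize the permuted matrix. Symmetrizers of an indecomposable matrix are
  proportional, and the factor is \<open>1\<close> because \<open>d\<close> and \<open>d \<circ> \<tau>\<close> have the same sum.
\<close>

lemma symmetrizer_invariant:
  fixes d :: "'n::finite \<Rightarrow> int"
  assumes d: "symmetrizer d B" "symmetrizer d (perm_matrix \<tau> B)" and "bij \<tau>" "indecomposable B"
  shows "d (\<tau> i) = d i"
proof -
  have \<tau>: "\<tau> (pinv \<tau> p) = p" for p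
    using \<open>bij \<tau>\<close> by (simp add: bij_is_surj surj_f_inv_f)
  have pos: "d i > 0" for i using d(1) by (simp add: symmetrizer_def)
  define r where "r p = real_of_int (d p) / real_of_int (d (pinv \<tau> p))" for p
  have edge: "r p = r q" if "B p q \<noteq> 0" for p q
  proof -
    have "d p * B p q = - (d q * B q p)"
      using d(1) unfolding symmetrizer_def by blast
    moreover have "d (pinv \<tau> p) * B p q = - (d (pinv \<tau> q) * B q p)"
      using d(2) unfolding symmetrizer_def perm_matrix_def by (metis \<tau>)
    ultimately have "d p * d (pinv \<tau> q) * B p q = d q * d (pinv \<tau> p) * B p q"
      by (metis mult.assoc mult.commute mult_minus_right)
    then have "d p * d (pinv \<tau> q) = d q * d (pinv \<tau> p)" using that by simp
    then show ?thesis
      unfolding r_def using pos[of "pinv \<tau> p"] pos[of "pinv \<tau> q"]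
      by (simp add: frac_eq_eq flip: of_int_mult)
  qed
  have "r p = r q" if "(\<lambda>a b. B a b \<noteq> 0)\<^sup>*\<^sup>* p q" for p q
    using that by induction (use edge in auto)
  then have r: "r p = r i" for p using assms(4) by (simp add: indecomposable_def)
  have "(\<Sum>p\<in>UNIV. real_of_int (d p)) = (\<Sum>p\<in>UNIV. r i * real_of_int (d (pinv \<tau> p)))"
  proof (rule sum.cong)
    show "real_of_int (d p) = r i * real_of_int (d (pinv \<tau> p))" for p
      using r[of p] pos[of "pinv \<tau> p"] by (simp add: r_def field_simps)
  qed simp
  also have "\<dots> = r i * (\<Sum>p\<in>UNIV. real_of_int (d p))"
    unfolding sum_distrib_left [symmetric]
    using sum.reindex_bij_betw[OF bij_imp_bij_inv[OF \<open>bij \<tau>\<close>], of "\<lambda>p. real_of_int (d p)"] by simp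
  moreover have "(\<Sum>p\<in>UNIV. real_of_int (d p)) > 0"
    by (rule sum_pos) (use pos in auto)
  ultimately have "r i = 1" by simp
  then have "r (\<tau> i) = 1" using r by simp
  moreover have "pinv \<tau> (\<tau> i) = i" using \<open>bij \<tau>\<close> by (simp add: bij_is_inj)
  ultimately show ?thesis using pos[of i] by (simp add: r_def)
qed

text \<open>
  A special case of the theorem that a seed is determined by its cluster. The relation between the
  clusters holds at every point of the positive orthant, hence for the curves \<open>t \<mapsto> exp (t u\<^sub>i)\<close>, whose
  logarithmic derivative is \<open>u\<close>. Along the sequence the two-form of \<open>C\<close> is preserved, but it ends as
  the two-form of \<open>-C\<close> in permuted coordinates.
\<close>

theorem opposite_seed_not_equivalent:
  fixes y :: "'n::finite \<Rightarrow> 'f::field_char_0"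
  assumes y: "alg_independent y" and "skew_symmetrizable C" and C: "indecomposable C" and "bij \<tau>"
    and eq: "mut_seq w (y, C) = perm_seed \<tau> (y, \<lambda>i j. - C i j)"
  shows "C = (\<lambda>i j. 0)"
proof -
  obtain d where d: "symmetrizer d C" using assms(2) by (auto simp: skew_symmetrizable_iff)
  then have dpos: "d i > 0" for i by (simp add: symmetrizer_def)
  have C': "mut_matrix_seq w C = perm_matrix \<tau> (\<lambda>i j. - C i j)"
    using arg_cong[OF eq, of snd] by (simp add: perm_seed_def)
  have "symmetrizer d (perm_matrix \<tau> (\<lambda>i j. - C i j))"
    using symmetrizer_mut_matrix_seq[OF d, of w] unfolding C' .
  then have "symmetrizer d (perm_matrix \<tau> C)"
    unfolding symmetrizer_def perm_matrix_def mult_minus_right neg_equal_iff_equal .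
  then have d\<tau>: "d (\<tau> i) = d i" for i
    by (rule symmetrizer_invariant[OF d _ \<open>bij \<tau>\<close> C])
  have real_mut: "fst (mut_seq w (a, C)) i = a (\<tau> i)" if "\<And>i. a i > 0" for a :: "'n \<Rightarrow> real" and i
  proof -
    have "specializes y a (y (\<tau> i)) (fst (mut_seq w (a, C)) i)"
      using specializes_mut_seq[where x = y and a = a and y = y and b = a,
          OF y specializes_var that, where w = w and B = C and i = i]
      by (simp add: eq perm_seed_Pair)
    then show ?thesis using specializes_functional[OF y _ specializes_var] by blast
  qed
  define e where "e = (\<lambda>i. 1 / real_of_int (d i))"
  have form_0: "two_form e C u v = 0" for u v
  proof -
    define f where "f u = (\<lambda>t i. exp (t * u i))" for u :: "'n \<Rightarrow> real"
    have f0: "f u 0 = (\<lambda>_. 1)" for u by (simp add: f_def)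
    have der: "((\<lambda>t. f u t i) has_real_derivative 1 * u i) (at 0)" for u i
      unfolding f_def by (auto intro!: derivative_eq_intros)
    obtain u' v' where
      u': "\<And>i. ((\<lambda>t. fst (mut_seq w (f u t, C)) i) has_real_derivative
          fst (mut_seq w (\<lambda>_. 1, C)) i * u' i) (at 0)" and
      v': "\<And>i. ((\<lambda>t. fst (mut_seq w (f v t, C)) i) has_real_derivative
          fst (mut_seq w (\<lambda>_. 1, C)) i * v' i) (at 0)" and
      form: "two_form e (mut_matrix_seq w C) u' v' = two_form e C u v"
      using two_form_mut_seq[OF d _ f0[of u] f0[of v] der der, where w = w] unfolding e_def by auto
    have f: "fst (mut_seq w (f u t, C)) i = f u t (\<tau> i)" for u t i
      by (rule real_mut) (simp add: f_def)
    have 1: "fst (mut_seq w (\<lambda>_. 1 :: real, C)) i = 1" for i by (simp add: real_mut)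
    have "u' i = u (\<tau> i)" "v' i = v (\<tau> i)" for i
      using DERIV_unique[OF u'[of i, unfolded f 1] der[of u "\<tau> i"]]
        DERIV_unique[OF v'[of i, unfolded f 1] der[of v "\<tau> i"]] by simp_all
    then have "two_form e C u v = (\<Sum>i\<in>UNIV. \<Sum>j\<in>UNIV. - (of_int (C (\<tau> i) (\<tau> j)) * e (\<tau> j) * u (\<tau> i) * v (\<tau> j)))"
      using form by (simp add: C' two_form_def perm_matrix_def e_def d\<tau>)
    also have "\<dots> = (\<Sum>i\<in>UNIV. \<Sum>j\<in>UNIV. - (of_int (C (\<tau> i) j) * e j * u (\<tau> i) * v j))"
      by (intro sum.cong refl sum.reindex_bij_betw[OF \<open>bij \<tau>\<close>])
    also have "\<dots> = (\<Sum>i\<in>UNIV. \<Sum>j\<in>UNIV. - (of_int (C i j) * e j * u i * v j))"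
      by (rule sum.reindex_bij_betw[OF \<open>bij \<tau>\<close>])
    also have "\<dots> = - two_form e C u v" by (simp add: two_form_def sum_negf)
    finally show ?thesis by simp
  qed
  have "C i j = 0" for i j
  proof -
    have "two_form e C (\<lambda>k. if k = i then 1 else 0) (\<lambda>k. if k = j then 1 else 0) = of_int (C i j) * e j"
      by (simp add: two_form_def if_distrib[of "\<lambda>x. _ * x"] sum.delta cong: if_cong)
    then show ?thesis using form_0 dpos[of j] by (simp add: e_def)
  qed
  then show ?thesis by (simp add: fun_eq_iff)
qed


section \<open>Cluster algebras and their automorphisms\<close>

lemma a_inv_ring_of_type_algebra:
  "\<ominus>\<^bsub>ring_of_type_algebra\<^esub> (a :: 'f::field) = - a"
proof -
  interpret ring "ring_of_type_algebra :: 'f ring" by (rule ring_from_type_algebra)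
  show ?thesis
    using minus_equality[of "- a" a] by (simp add: ring_of_type_algebra_def)
qed

abbreviation cluster_ring :: "('n::finite, 'f::field_char_0) lseed \<Rightarrow> 'f set" where
  "cluster_ring s \<equiv> carrier (cluster_algebra s)"

lemma cluster_ring_eq:
  "cluster_ring s = generate_ring ring_of_type_algebra (\<Union>t\<in>seeds s. range (fst t))"
proof -
  have "(\<Union>t\<in>seeds s. range (fst t)) = (\<Union>t\<in>mut_class s. range (fst t))"
  proof (intro equalityI subsetI)
    fix a assume "a \<in> (\<Union>t\<in>seeds s. range (fst t))"
    then obtain \<sigma> t i where "t \<in> mut_class s" "a = fst (perm_seed \<sigma> t) i"
      unfolding seeds_def by blast
    then have "a = fst t (\<sigma> i)" by (simp add: perm_seed_def)
    with \<open>t \<in> mut_class s\<close> show "a \<in> (\<Union>t\<in>mut_class s. range (fst t))" by blast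
  next
    fix a assume "a \<in> (\<Union>t\<in>mut_class s. range (fst t))"
    then show "a \<in> (\<Union>t\<in>seeds s. range (fst t))"
      unfolding mut_class_def using mut_seq_in_seeds by blast
  qed
  then show ?thesis by (simp add: cluster_algebra_def)
qed

lemma cluster_algebra_simps [simp]:
  "\<one>\<^bsub>cluster_algebra s\<^esub> = 1" "a \<otimes>\<^bsub>cluster_algebra s\<^esub> b = a * b" "a \<oplus>\<^bsub>cluster_algebra s\<^esub> b = a + b"
  by (simp_all add: cluster_algebra_def ring_of_type_algebra_def)

lemma cluster_ring_closed:
  shows "1 \<in> cluster_ring s"
    and "a \<in> cluster_ring s \<Longrightarrow> - a \<in> cluster_ring s"
    and "a \<in> cluster_ring s \<Longrightarrow> b \<in> cluster_ring s \<Longrightarrow> a + b \<in> cluster_ring s"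
    and "a \<in> cluster_ring s \<Longrightarrow> b \<in> cluster_ring s \<Longrightarrow> a * b \<in> cluster_ring s"
  using generate_ring.one[of "ring_of_type_algebra :: 'a ring"]
    generate_ring.a_inv[of a "ring_of_type_algebra :: 'a ring"]
    generate_ring.eng_add[of a "ring_of_type_algebra :: 'a ring" _ b]
    generate_ring.eng_mult[of a "ring_of_type_algebra :: 'a ring" _ b]
  unfolding cluster_ring_eq a_inv_ring_of_type_algebra
  by (simp_all add: ring_of_type_algebra_def)

lemma cluster_variable_in_ring: "t \<in> seeds s \<Longrightarrow> fst t i \<in> cluster_ring s"
  unfolding cluster_ring_eq by (rule generate_ring.incl) blast

lemma cluster_ring_induct [consumes 1, case_names one var uminus add mult]:
  assumes "a \<in> cluster_ring s" and "P 1" and "\<And>t i. t \<in> seeds s \<Longrightarrow> P (fst t i)"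
    and "\<And>a. a \<in> cluster_ring s \<Longrightarrow> P a \<Longrightarrow> P (- a)"
    and "\<And>a b. a \<in> cluster_ring s \<Longrightarrow> b \<in> cluster_ring s \<Longrightarrow> P a \<Longrightarrow> P b \<Longrightarrow> P (a + b)"
    and "\<And>a b. a \<in> cluster_ring s \<Longrightarrow> b \<in> cluster_ring s \<Longrightarrow> P a \<Longrightarrow> P b \<Longrightarrow> P (a * b)"
  shows "P a"
  using assms(1) unfolding cluster_ring_eq
proof (induction rule: generate_ring.induct)
  case one
  then show ?case using assms(2) by (simp add: ring_of_type_algebra_def)
next
  case (incl h)
  then show ?case using assms(3) by blast
next
  case (a_inv h)
  then show ?case
    using assms(4) by (simp add: a_inv_ring_of_type_algebra cluster_ring_eq)
next
  case (eng_add h1 h2)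
  then show ?case
    using assms(5)[of h1 h2] by (simp add: cluster_ring_eq) (simp add: ring_of_type_algebra_def)
next
  case (eng_mult h1 h2)
  then show ?case
    using assms(6)[of h1 h2] by (simp add: cluster_ring_eq) (simp add: ring_of_type_algebra_def)
qed

definition map_seed :: "('f \<Rightarrow> 'g) \<Rightarrow> ('n, 'f) lseed \<Rightarrow> ('n, 'g) lseed" where
  "map_seed f s = (f \<circ> fst s, snd s)"

lemma fst_map_seed [simp]: "fst (map_seed f s) = f \<circ> fst s"
  and snd_map_seed [simp]: "snd (map_seed f s) = snd s"
  by (simp_all add: map_seed_def)

lemma map_seed_perm_seed: "map_seed f (perm_seed \<sigma> t) = perm_seed \<sigma> (map_seed f t)"
  by (simp add: map_seed_def perm_seed_def comp_assoc)

text \<open>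
  Stated for a ring homomorphism that is only defined on a subring \<open>S\<close>, as it is applied both to field
  automorphisms and to automorphisms of the cluster algebra. There is no division in \<open>S\<close>, so the
  exchange relation is used in the form \<open>x\<^sub>k x'\<^sub>k = P + Q\<close>.
\<close>

lemma map_seed_mut:
  fixes t :: "('n::finite, 'f::field_char_0) lseed" and f :: "'f \<Rightarrow> 'g::field_char_0"
  assumes one: "1 \<in> S" "f 1 = 1"
    and add: "\<And>a b. a \<in> S \<Longrightarrow> b \<in> S \<Longrightarrow> a + b \<in> S \<and> f (a + b) = f a + f b"
    and mult: "\<And>a b. a \<in> S \<Longrightarrow> b \<in> S \<Longrightarrow> a * b \<in> S \<and> f (a * b) = f a * f b"
    and t: "range (fst t) \<subseteq> S" "mut_var k t \<in> S" "fst t k \<noteq> 0" "f (fst t k) \<noteq> 0"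
  shows "map_seed f (mut k t) = mut k (map_seed f t)"
proof -
  obtain x B where xB: "t = (x, B)" by (cases t)
  have pow: "a ^ n \<in> S \<and> f (a ^ n) = f a ^ n" if "a \<in> S" for a and n :: nat
    by (induction n) (use one mult that in auto)
  have prod: "prod u I \<in> S \<and> f (prod u I) = (\<Prod>i\<in>I. f (u i))" if "\<And>i. u i \<in> S"
    for u :: "'n \<Rightarrow> 'f" and I
    by (induction I rule: infinite_finite_induct) (use one mult that in auto)
  have monomial: "(\<Prod>i\<in>UNIV. x i ^ n i) \<in> S \<and> f (\<Prod>i\<in>UNIV. x i ^ n i) = (\<Prod>i\<in>UNIV. f (x i) ^ n i)" for n
  proof -
    have "x i \<in> S" for i using t(1) by (auto simp: xB)
    with prod[of "\<lambda>i. x i ^ n i" UNIV] pow show ?thesis by simp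
  qed
  have "mut_var k t * x k = (\<Prod>i\<in>UNIV. x i ^ nat (B i k)) + (\<Prod>i\<in>UNIV. x i ^ nat (- B i k))"
    using t(3) by (simp add: mut_var_def xB)
  then have "f (mut_var k t * x k) =
      f ((\<Prod>i\<in>UNIV. x i ^ nat (B i k)) + (\<Prod>i\<in>UNIV. x i ^ nat (- B i k)))" by simp
  moreover have "f (mut_var k t * x k) = f (mut_var k t) * f (x k)"
    using mult[of "mut_var k t" "x k"] t by (auto simp: xB)
  moreover have "f ((\<Prod>i\<in>UNIV. x i ^ nat (B i k)) + (\<Prod>i\<in>UNIV. x i ^ nat (- B i k))) =
      (\<Prod>i\<in>UNIV. f (x i) ^ nat (B i k)) + (\<Prod>i\<in>UNIV. f (x i) ^ nat (- B i k))"
    by (simp only: add[OF monomial[THEN conjunct1] monomial[THEN conjunct1], THEN conjunct2]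
        monomial[THEN conjunct2])
  ultimately have "f (mut_var k t) = mut_var k (f \<circ> x, B)"
    using t(4) by (simp add: mut_var_def xB field_simps)
  then show ?thesis
    by (auto simp: map_seed_def mut_def xB fun_eq_iff)
qed

lemma map_seed_mut_seq:
  assumes "\<And>k t. t \<in> seeds s \<Longrightarrow> map_seed f (mut k t) = mut k (map_seed f t)"
    and "t \<in> seeds s"
  shows "map_seed f (mut_seq w t) = mut_seq w (map_seed f t)"
  using assms(2)
proof (induction w arbitrary: t)
  case (Cons k w)
  then show ?case using mut_in_seeds[OF Cons.prems, of k] by (simp only: mut_seq_simps assms(1))
qed simp


subsection \<open>The field automorphism that moves one free generating set to another\<close>

definition subst_hom ::
  "('n \<Rightarrow> 'f::field_char_0) \<Rightarrow> ('n \<Rightarrow> 'f) \<Rightarrow> 'f \<Rightarrow> 'f" where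
  "subst_hom x z u = (THE v. specializes x z u v)"

context
  fixes x z :: "'n::finite \<Rightarrow> 'f::field_char_0"
  assumes x: "free_generators x" and z: "free_generators z"
begin

lemma specializes_subst_hom: "specializes x z u (subst_hom x z u)"
proof -
  have *: "alg_independent x" "ratfun x u" "alg_independent z"
    using x z by (auto simp: free_generators_iff)
  obtain p q where "poly_eval x q \<noteq> 0" "u = poly_eval x p / poly_eval x q"
    using *(2) unfolding ratfun_def by blast
  moreover from this have "poly_eval z q \<noteq> 0"
    using *(3) unfolding alg_independent_def by force
  ultimately have "\<exists>v. specializes x z u v" unfolding specializes_def by blast
  then have "\<exists>!v. specializes x z u v"
    using specializes_functional[OF *(1)] by blast
  then show ?thesis unfolding subst_hom_def by (rule theI')
qed

lemma subst_hom_eqI: "specializes x z u v \<Longrightarrow> subst_hom x z u = v"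
  using specializes_functional[OF _ specializes_subst_hom] x by (auto simp: free_generators_iff)

lemma subst_hom_var: "subst_hom x z (x i) = z i"
  by (intro subst_hom_eqI specializes_var)

lemma subst_hom_hom:
  "subst_hom x z 1 = 1" "subst_hom x z 0 = 0"
  "subst_hom x z (u + v) = subst_hom x z u + subst_hom x z v"
  "subst_hom x z (u * v) = subst_hom x z u * subst_hom x z v"
  "subst_hom x z (- u) = - subst_hom x z u"
  by (intro subst_hom_eqI specializes_1 specializes_0 specializes_add specializes_mult
      specializes_uminus specializes_subst_hom)+

end

lemma subst_hom_inverse:
  fixes x z :: "'n::finite \<Rightarrow> 'f::field_char_0"
  assumes "free_generators x" "free_generators z"
  shows "subst_hom z x (subst_hom x z u) = u"
  by (intro subst_hom_eqI assms) (subst specializes_sym, intro specializes_subst_hom assms)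

lemma map_seed_subst_hom:
  fixes s s' :: "('n::finite, 'f::field_char_0) lseed"
  assumes s: "labeled_seed s" and s': "labeled_seed s'" and eq: "snd s = snd s'"
  defines "f \<equiv> subst_hom (fst s) (fst s')"
  shows "map_seed f (mut_seq w s) = mut_seq w s'"
proof -
  note free = labeled_seedD(1)[OF s] labeled_seedD(1)[OF s']
  note hom = subst_hom_hom[OF free, folded f_def]
  have "map_seed f (mut k t) = mut k (map_seed f t)" if "t \<in> seeds s" for k t
  proof (rule map_seed_mut[where S = UNIV])
    note t = labeled_seedD[OF labeled_seed_seeds[OF s that]]
    show "fst t k \<noteq> 0" by (rule t)
    show "f (fst t k) \<noteq> 0"
      using subst_hom_inverse[OF free, folded f_def, of "fst t k"] subst_hom_hom(2)[OF free(2,1)]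
        t(7)[of k] by auto
  qed (simp_all add: hom)
  then have "map_seed f (mut_seq w s) = mut_seq w (map_seed f s)"
    using map_seed_mut_seq[OF _ seed_in_seeds] by blast
  also have "map_seed f s = s'"
    using subst_hom_var[OF free] eq by (simp add: map_seed_def f_def comp_def prod_eq_iff)
  finally show ?thesis .
qed

text \<open>
  The substitution from one seed to the other carries a relation over.
\<close>

lemma periodicity_transfer:
  fixes s s' :: "('n::finite, 'f::field_char_0) lseed"
  assumes "labeled_seed s" "labeled_seed s'" "snd s = snd s'"
    and "mut_seq w s = perm_seed \<tau> s"
  shows "mut_seq w s' = perm_seed \<tau> s'"
  using map_seed_subst_hom[OF assms(1-3), of w] map_seed_subst_hom[OF assms(1-3), of "[]"]
  by (simp add: assms(4) map_seed_perm_seed)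

text \<open>
  The substitution maps seeds of one algebra to seeds of the other, hence generators to generators.
\<close>

lemma subst_hom_cluster_ring:
  fixes s s' :: "('n::finite, 'f::field_char_0) lseed"
  assumes "labeled_seed s" "labeled_seed s'" "snd s = snd s'" and a: "a \<in> cluster_ring s"
  shows "subst_hom (fst s) (fst s') a \<in> cluster_ring s'"
proof -
  note hom = subst_hom_hom[OF assms(1,2)[THEN labeled_seedD(1)]]
  from a show ?thesis
  proof (induction rule: cluster_ring_induct)
    case (var t i)
    then obtain \<sigma> w where \<sigma>: "bij \<sigma>" "t = perm_seed \<sigma> (mut_seq w s)"
      unfolding seeds_iff by blast
    have "map_seed (subst_hom (fst s) (fst s')) t = perm_seed \<sigma> (mut_seq w s')"
      unfolding \<sigma> map_seed_perm_seed map_seed_subst_hom[OF assms(1-3)] ..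
    also have "\<dots> \<in> seeds s'" using \<sigma>(1) unfolding seeds_iff by blast
    finally show ?case using cluster_variable_in_ring[of _ s' i] by fastforce
  qed (simp_all add: hom cluster_ring_closed)
qed


subsection \<open>Algebra automorphisms\<close>

lemma alg_auts_iff:
  "f \<in> alg_auts s \<longleftrightarrow> f \<in> extensional (cluster_ring s) \<and> bij_betw f (cluster_ring s) (cluster_ring s) \<and>
     f 1 = 1 \<and>
     (\<forall>a\<in>cluster_ring s. \<forall>b\<in>cluster_ring s. f (a + b) = f a + f b \<and> f (a * b) = f a * f b)"
  by (auto simp: alg_auts_def ring_iso_def ring_hom_def Pi_iff dest: bij_betwE)

locale initial_seed =
  fixes s :: "('n::finite, 'f::field_char_0) lseed"
  assumes seed: "labeled_seed s"
begin

abbreviation "\<A> \<equiv> cluster_ring s"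

lemma zero_in_ring: "0 \<in> \<A>"
  using cluster_ring_closed(3)[OF cluster_ring_closed(1) cluster_ring_closed(2)[OF cluster_ring_closed(1)], of s]
  by simp

lemma alg_autsD:
  assumes "f \<in> alg_auts s"
  shows "f \<in> Bij \<A>" "f \<in> extensional \<A>" "bij_betw f \<A> \<A>" "f 1 = 1"
    and "a \<in> \<A> \<Longrightarrow> f a \<in> \<A>"
    and "a \<in> \<A> \<Longrightarrow> b \<in> \<A> \<Longrightarrow> f (a + b) = f a + f b"
    and "a \<in> \<A> \<Longrightarrow> b \<in> \<A> \<Longrightarrow> f (a * b) = f a * f b"
    and "a \<in> \<A> \<Longrightarrow> f a = 0 \<longleftrightarrow> a = 0" and "a \<in> \<A> \<Longrightarrow> f (- a) = - f a"
proof -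
  show *: "f \<in> Bij \<A>" "f \<in> extensional \<A>" "bij_betw f \<A> \<A>" "f 1 = 1"
    "a \<in> \<A> \<Longrightarrow> f a \<in> \<A>" "a \<in> \<A> \<Longrightarrow> b \<in> \<A> \<Longrightarrow> f (a * b) = f a * f b"
    and add: "a \<in> \<A> \<Longrightarrow> b \<in> \<A> \<Longrightarrow> f (a + b) = f a + f b" for a b
    using assms by (auto simp: alg_auts_iff Bij_def dest: bij_betwE)
  have f0: "f 0 = 0" using add[OF zero_in_ring zero_in_ring] by simp
  then show "f a = 0 \<longleftrightarrow> a = 0" if "a \<in> \<A>"
    using bij_betw_imp_inj_on[OF *(3)] that zero_in_ring by (metis inj_onD)
  show "f (- a) = - f a" if "a \<in> \<A>"
    using add[OF that cluster_ring_closed(2)[OF that]] f0 by (simp add: eq_neg_iff_add_eq_0 add.commute)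
qed

lemma map_seed_aut_mut_seq:
  assumes f: "f \<in> alg_auts s" and t: "t \<in> seeds s"
  shows "map_seed f (mut_seq w t) = mut_seq w (map_seed f t)"
proof (rule map_seed_mut_seq[OF _ t])
  show "map_seed f (mut k t) = mut k (map_seed f t)" if t: "t \<in> seeds s" for k t
  proof (rule map_seed_mut[where S = \<A>])
    show "range (fst t) \<subseteq> \<A>" using cluster_variable_in_ring[OF t] by auto
    show "mut_var k t \<in> \<A>"
      using cluster_variable_in_ring[OF mut_in_seeds[OF t], of k k] by (simp add: mut_def)
    show nz: "fst t k \<noteq> 0" by (rule labeled_seedD(7)[OF labeled_seed_seeds[OF seed t]])
    show "f (fst t k) \<noteq> 0"
      using alg_autsD(8)[OF f cluster_variable_in_ring[OF t]] nz by simp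
  qed (auto simp: alg_autsD(4,6,7)[OF f] intro: cluster_ring_closed)
qed

lemma aut_mut_var:
  assumes "f \<in> alg_auts s" "t \<in> seeds s"
  shows "f (mut_var k t) = mut_var k (f \<circ> fst t, snd t)"
proof -
  have "map_seed f (mut k t) = mut k (map_seed f t)"
    using map_seed_aut_mut_seq[OF assms, of "[k]"] by simp
  then have "fst (map_seed f (mut k t)) k = fst (mut k (map_seed f t)) k" by simp
  then show ?thesis by (simp add: mut_def map_seed_def)
qed

lemma map_seed_seeds:
  assumes f: "f \<in> alg_auts s" and u: "u \<in> seeds s" "map_seed f u \<in> seeds s" and t: "t \<in> seeds s"
  shows "map_seed f t \<in> seeds s"
proof -
  have "t \<in> seeds u" using seeds_eq[OF seed u(1)] t by simp
  then obtain \<sigma> w where \<sigma>: "bij \<sigma>" "t = perm_seed \<sigma> (mut_seq w u)"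
    unfolding seeds_iff by blast
  show ?thesis
    unfolding \<sigma>(2) map_seed_perm_seed map_seed_aut_mut_seq[OF f u(1)]
    by (intro perm_seed_in_seeds mut_seq_in_seeds' u \<sigma>(1))
qed

text \<open>
  Automorphisms commute with mutations, so the values on one cluster determine those on all others,
  and these generate the algebra.
\<close>

lemma alg_auts_eqI:
  assumes f: "f \<in> alg_auts s" and g: "g \<in> alg_auts s" and eq: "map_seed f s = map_seed g s"
  shows "f = g"
proof (rule extensionalityI)
  show "f a = g a" if "a \<in> \<A>" for a
    using that
  proof (induction rule: cluster_ring_induct)
    case (var t i)
    then obtain \<sigma> w where \<sigma>: "t = perm_seed \<sigma> (mut_seq w s)"
      unfolding seeds_iff by blast
    have "map_seed f t = map_seed g t"
      unfolding \<sigma> map_seed_perm_seed map_seed_aut_mut_seq[OF f seed_in_seeds]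
        map_seed_aut_mut_seq[OF g seed_in_seeds] eq ..
    then show ?case by (metis comp_apply fst_map_seed)
  qed (simp_all add: alg_autsD[OF f] alg_autsD[OF g])
qed (use alg_autsD(2) f g in auto)

text \<open>
  The cluster algebra only depends on the set of seeds, which may be computed from \<open>t\<close> instead of \<open>s\<close>.
  So the substitution from \<open>s\<close> to \<open>t\<close> and its inverse both map the algebra to itself.
\<close>

lemma alg_aut_exists:
  assumes t: "t \<in> seeds s" and eq: "snd t = snd s"
  shows "\<exists>f\<in>alg_auts s. map_seed f s = t"
proof -
  note t' = labeled_seed_seeds[OF seed t]
  note free = labeled_seedD(1)[OF seed] labeled_seedD(1)[OF t']
  have ring: "cluster_ring t = \<A>"
    by (simp only: cluster_ring_eq seeds_eq[OF seed t])
  define E where "E = subst_hom (fst s) (fst t)"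
  define f where "f = restrict E \<A>"
  have E: "E a \<in> \<A>" if "a \<in> \<A>" for a
    using subst_hom_cluster_ring[OF seed t' eq[symmetric] that] by (simp add: ring E_def)
  have "bij_betw f \<A> \<A>"
  proof (rule bij_betw_byWitness[where f' = "subst_hom (fst t) (fst s)"])
    show "\<forall>a\<in>\<A>. subst_hom (fst t) (fst s) (f a) = a"
      by (simp add: f_def E_def subst_hom_inverse[OF free])
    have *: "subst_hom (fst t) (fst s) a \<in> \<A>" if "a \<in> \<A>" for a
      using subst_hom_cluster_ring[OF t' seed eq] that by (simp add: ring)
    then show "\<forall>a\<in>\<A>. f (subst_hom (fst t) (fst s) a) = a"
      by (simp add: f_def E_def subst_hom_inverse[OF free(2,1)])
    show "f ` \<A> \<subseteq> \<A>" "subst_hom (fst t) (fst s) ` \<A> \<subseteq> \<A>"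
      using E * by (auto simp: f_def)
  qed
  then have "f \<in> alg_auts s"
    unfolding alg_auts_iff
    by (simp add: f_def cluster_ring_closed E_def subst_hom_hom[OF free])
  moreover have "map_seed f s = t"
    using subst_hom_var[OF free] cluster_variable_in_ring[OF seed_in_seeds, of s] eq
    by (simp add: map_seed_def f_def E_def prod_eq_iff comp_def)
  ultimately show ?thesis by blast
qed


subsection \<open>Direct and strict direct cluster automorphisms\<close>

text \<open>
  Compatibility with mutations comes for free: a ring homomorphism respects exchange relations, and
  the image of a seed is taken with the matrix of that seed.
\<close>

lemma direct_cluster_aut_iff:
  "direct_cluster_aut s f \<longleftrightarrow> f \<in> alg_auts s \<and> map_seed f s \<in> seeds s"
proof (intro iffI conjI)
  assume "direct_cluster_aut s f"
  then show "f \<in> alg_auts s" "map_seed f s \<in> seeds s"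
    by (auto simp: direct_cluster_aut_def cluster_aut_def map_seed_def)
next
  assume *: "f \<in> alg_auts s \<and> map_seed f s \<in> seeds s"
  then have seeds: "map_seed f t \<in> seeds s" if "t \<in> seeds s" for t
    using map_seed_seeds[of f s t] that by simp
  have "mut_compatible f s (snd s)"
    using aut_mut_var[OF _ seed_in_seeds] * by (simp add: mut_compatible_def)
  moreover have "f ` range (fst s) \<in> clusters s"
    unfolding clusters_def using * by (auto simp: image_comp intro!: image_eqI[of _ _ "map_seed f s"])
  ultimately show "direct_cluster_aut s f"
    unfolding direct_cluster_aut_def cluster_aut_def
    using * seeds seed_in_seeds[of s] unfolding map_seed_def by blast
qed

lemma opposite_seed_imp_zero:
  assumes "(y, C) \<in> seeds s" "(y, \<lambda>i j. - C i j) \<in> seeds s"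
  shows "C = (\<lambda>i j. 0)"
proof -
  have "(y, \<lambda>i j. - C i j) \<in> seeds (y, C)"
    using seeds_eq[OF seed assms(1)] assms(2) by simp
  then obtain \<sigma> w where \<sigma>: "bij \<sigma>" "(y, \<lambda>i j. - C i j) = perm_seed \<sigma> (mut_seq w (y, C))"
    unfolding seeds_iff by blast
  have "mut_seq w (y, C) = perm_seed (pinv \<sigma>) (y, \<lambda>i j. - C i j)"
    using \<sigma>(1) by (simp add: \<sigma>(2))
  with labeled_seedD[OF labeled_seed_seeds[OF seed assms(1)]] show ?thesis
    using opposite_seed_not_equivalent[of y C "pinv \<sigma>" w] \<sigma>(1)
    by (simp add: bij_imp_bij_inv)
qed

text \<open>
  This is where the exchange matrix has to be recovered from the cluster, in order to replace the
  matrix \<open>C\<close> of the definition by that of \<open>t\<close>. Once \<open>f\<close> maps the labeled seed \<open>t\<close> to \<open>\<mu>\<^sub>w t\<close>,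
  conjugation by a mutation sequence and a relabeling from \<open>s\<close> to \<open>t\<close> gives the same for \<open>s\<close>.
\<close>

lemma strict_direct_cluster_aut_iff:
  "strict_direct_cluster_aut s f \<longleftrightarrow> f \<in> alg_auts s \<and> (\<exists>w. map_seed f s = mut_seq w s)"
proof (intro iffI)
  assume *: "f \<in> alg_auts s \<and> (\<exists>w. map_seed f s = mut_seq w s)"
  then obtain w where f: "f \<in> alg_auts s" and w: "map_seed f s = mut_seq w s" by blast
  have "mut_compatible f s (snd s)"
    using aut_mut_var[OF f seed_in_seeds] by (simp add: mut_compatible_def)
  then show "strict_direct_cluster_aut s f"
    using f w seed_in_seeds[of s] mut_seq_in_seeds[of w s]
    unfolding strict_direct_cluster_aut_def strict_cluster_aut_def map_seed_def by metis
next
  assume *: "strict_direct_cluster_aut s f"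
  then obtain t C w where f: "f \<in> alg_auts s" "(f \<circ> fst s, snd s) \<in> seeds s"
    and t: "t \<in> seeds s" and C: "(f \<circ> fst t, C) \<in> seeds s" "(f \<circ> fst t, C) = mut_seq w t"
      "mut_compatible f t C"
    unfolding strict_direct_cluster_aut_def strict_cluster_aut_def by blast
  have ft: "map_seed f t \<in> seeds s"
    using map_seed_seeds[OF f(1) seed_in_seeds _ t] f(2) by (simp add: map_seed_def)
  note lft = labeled_seedD[OF labeled_seed_seeds[OF seed ft]]
    and lC = labeled_seedD[OF labeled_seed_seeds[OF seed C(1)]]
  have "mut_var k (f \<circ> fst t, snd t) = mut_var k (f \<circ> fst t, C)" for k
    using C(3) aut_mut_var[OF f(1) t] by (simp add: mut_compatible_def)
  then have "(\<forall>i. C i k = snd t i k) \<or> (\<forall>i. C i k = - snd t i k)" for k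
    by (rule exchange_column_unique[OF lC(2), unfolded fst_conv])
  then have "C = snd t \<or> C = (\<lambda>i j. - snd t i j)"
    using columns_unique_imp_sign lft(4,5) lC(4) by (metis snd_conv snd_map_seed)
  moreover have "C = snd t" if "C = (\<lambda>i j. - snd t i j)"
    using opposite_seed_imp_zero[of "f \<circ> fst t" "snd t"] ft C(1) that by (simp add: map_seed_def)
  ultimately have fw: "map_seed f t = mut_seq w t" using C(2) by (auto simp: map_seed_def)
  obtain \<sigma> v where \<sigma>: "bij \<sigma>" "t = perm_seed \<sigma> (mut_seq v s)"
    using t unfolding seeds_iff by blast
  \<comment> \<open>Relabeling commutes with \<open>f\<close> and renames the letters of \<open>w\<close>, so it can be stripped off.\<close>
  have "perm_seed \<sigma> (map_seed f (mut_seq v s)) = perm_seed \<sigma> (mut_seq (map \<sigma> w) (mut_seq v s))"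
    using fw \<sigma> by (simp only: map_seed_perm_seed mut_seq_perm_seed)
  then have "perm_seed (pinv \<sigma>) (perm_seed \<sigma> (map_seed f (mut_seq v s))) =
      perm_seed (pinv \<sigma>) (perm_seed \<sigma> (mut_seq (map \<sigma> w) (mut_seq v s)))" by simp
  then have "map_seed f (mut_seq v s) = mut_seq (map \<sigma> w) (mut_seq v s)"
    using \<sigma>(1) by simp
  then have "map_seed f (mut_seq (rev v) (mut_seq v s)) = mut_seq (rev v) (mut_seq (map \<sigma> w) (mut_seq v s))"
    by (subst map_seed_aut_mut_seq[OF f(1) mut_seq_in_seeds]) simp
  then have "map_seed f s = mut_seq (v @ map \<sigma> w @ rev v) s"
    using seed by simp
  then show "f \<in> alg_auts s \<and> (\<exists>w. map_seed f s = mut_seq w s)" using f(1) by blast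
qed

end


section \<open>Words modulo squares\<close>

lemma equiv_word_equiv: "equiv UNIV word_equiv"
proof (rule equivI)
  show "refl word_equiv" "sym word_equiv" "trans word_equiv"
    unfolding word_equiv_def Let_def
    by (auto intro: refl_rtrancl sym_rtrancl trans_rtrancl simp: sym_Un_converse)
qed auto

lemma word_equiv_refl: "(a, a) \<in> word_equiv"
  unfolding word_equiv_def Let_def by (rule rtrancl_refl)

lemma word_equiv_sym: "(a, b) \<in> word_equiv \<Longrightarrow> (b, a) \<in> word_equiv"
  using equiv_word_equiv by (rule equivE) (erule symD)

lemma word_equiv_trans: "(a, b) \<in> word_equiv \<Longrightarrow> (b, c) \<in> word_equiv \<Longrightarrow> (a, c) \<in> word_equiv"
  unfolding word_equiv_def Let_def by (rule rtrancl_trans)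

lemma word_equiv_induct [consumes 1, case_names refl insert delete]:
  assumes "(a, b) \<in> word_equiv" and "P a"
    and "\<And>u v i. P (u @ v) \<Longrightarrow> P (u @ [i, i] @ v)" and "\<And>u v i. P (u @ [i, i] @ v) \<Longrightarrow> P (u @ v)"
  shows "P b"
  using assms(1) unfolding word_equiv_def Let_def
proof (induction rule: rtrancl_induct)
  case base
  show ?case by (rule assms(2))
next
  case (step b c)
  then obtain u v i where "b = u @ v \<and> c = u @ [i, i] @ v \<or> c = u @ v \<and> b = u @ [i, i] @ v"
    by blast
  then show ?case using step.IH assms(3,4) by blast
qed

lemma word_equiv_step: "(u @ v, u @ [i, i] @ v) \<in> word_equiv"
  unfolding word_equiv_def Let_def by (rule r_into_rtrancl) blast

lemma word_equiv_append:
  assumes "(a, b) \<in> word_equiv"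
  shows "(p @ a @ q, p @ b @ q) \<in> word_equiv"
  using assms
proof (induction rule: word_equiv_induct)
  case refl
  show ?case by (rule word_equiv_refl)
next
  case (insert u v i)
  then show ?case
    using word_equiv_step[of "p @ u" "v @ q" i] by (auto intro: word_equiv_trans)
next
  case (delete u v i)
  then show ?case
    using word_equiv_step[of "p @ u" "v @ q" i] by (auto intro: word_equiv_trans word_equiv_sym)
qed

lemma word_equiv_append2:
  assumes "(a, b) \<in> word_equiv" "(c, d) \<in> word_equiv"
  shows "(a @ c, b @ d) \<in> word_equiv"
proof -
  have "(a @ c, b @ c) \<in> word_equiv" using word_equiv_append[OF assms(1), of "[]" c] by simp
  moreover have "(b @ c, b @ d) \<in> word_equiv" using word_equiv_append[OF assms(2), of b "[]"] by simp
  ultimately show ?thesis by (rule word_equiv_trans)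
qed

lemma mu_eq_iff: "mu v = mu w \<longleftrightarrow> (rev v, rev w) \<in> word_equiv"
  unfolding mu_def using eq_equiv_class_iff[OF equiv_word_equiv] by simp

lemma mutation_group_mult: "mu v \<otimes>\<^bsub>mutation_group\<^esub> mu w = mu (w @ v)"
proof -
  have in_class: "a \<in> word_equiv `` {a}" for a :: "'a list"
    using word_equiv_refl by simp
  have "(\<Union>a\<in>mu v. \<Union>b\<in>mu w. word_equiv `` {a @ b}) = mu (w @ v)"
  proof -
    have "word_equiv `` {a @ b} = mu (w @ v)" if "a \<in> mu v" "b \<in> mu w" for a b
      unfolding mu_def rev_append
      using that word_equiv_append2[of "rev v" a "rev w" b]
      by (intro equiv_class_eq[OF equiv_word_equiv, symmetric]) (simp add: mu_def)
    moreover have "rev v \<in> mu v" "rev w \<in> mu w" unfolding mu_def by (rule in_class)+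
    ultimately show ?thesis by blast
  qed
  then show ?thesis by (simp add: mutation_group_def)
qed

lemma mu_rev_append: "mu (w @ rev w) = mu []"
proof (induction w)
  case (Cons k w)
  have "mu (k # (w @ rev w) @ [k]) = mu ([k] @ [] @ [k])"
    using word_equiv_append[of "rev (w @ rev w)" "[]" "[k]" "[k]"] Cons.IH
    unfolding mu_eq_iff by simp
  also have "\<dots> = mu []"
  proof -
    have "(rev [k, k], []) \<in> word_equiv"
      using word_equiv_sym[OF word_equiv_step[of "[]" "[]" k]] by simp
    then show ?thesis by (simp add: mu_eq_iff)
  qed
  finally show ?case by simp
qed simp

text \<open>
  The common shape of the two period groups; passing to the opposite group turns the reversed
  composition of mutations into concatenation of words.
\<close>

definition word_group :: "('n list \<Rightarrow> bool) \<Rightarrow> 'n list set monoid" where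
  "word_group P = opposite_group (mutation_group\<lparr>carrier := {mu w | w. P w}\<rparr>)"

lemma word_group_simps:
  "carrier (word_group P) = {mu w | w. P w}" "\<one>\<^bsub>word_group P\<^esub> = mu []"
  "mu v \<otimes>\<^bsub>word_group P\<^esub> mu w = mu (v @ w)"
  using mutation_group_mult[of w v]
  by (simp_all add: word_group_def opposite_group_def) (simp add: mutation_group_def mu_def)

lemma group_word_group:
  assumes "P []" "\<And>v w. P v \<Longrightarrow> P w \<Longrightarrow> P (v @ w)" "\<And>w. P w \<Longrightarrow> P (rev w)"
  shows "group (word_group P)"
proof (rule groupI)
  fix U V W assume "U \<in> carrier (word_group P)" "V \<in> carrier (word_group P)" "W \<in> carrier (word_group P)"
  then obtain u v w where "U = mu u" "V = mu v" "W = mu w" "P u" "P v"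
    by (auto simp: word_group_simps)
  then show "U \<otimes>\<^bsub>word_group P\<^esub> V \<in> carrier (word_group P)"
    "U \<otimes>\<^bsub>word_group P\<^esub> V \<otimes>\<^bsub>word_group P\<^esub> W = U \<otimes>\<^bsub>word_group P\<^esub> (V \<otimes>\<^bsub>word_group P\<^esub> W)"
    using assms(2) by (auto simp: word_group_simps)
next
  show "\<one>\<^bsub>word_group P\<^esub> \<in> carrier (word_group P)"
    using assms(1) by (auto simp: word_group_simps)
  fix U assume "U \<in> carrier (word_group P)"
  then obtain w where w: "U = mu w" "P w" by (auto simp: word_group_simps)
  then show "\<one>\<^bsub>word_group P\<^esub> \<otimes>\<^bsub>word_group P\<^esub> U = U" by (simp add: word_group_simps)
  have "mu (rev w) \<otimes>\<^bsub>word_group P\<^esub> U = \<one>\<^bsub>word_group P\<^esub>"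
    using mu_rev_append[of "rev w"] by (simp add: w word_group_simps)
  then show "\<exists>V\<in>carrier (word_group P). V \<otimes>\<^bsub>word_group P\<^esub> U = \<one>\<^bsub>word_group P\<^esub>"
    using assms(3)[OF w(2)] by (auto simp: word_group_simps)
qed

lemma G_group_eq: "G_group B = word_group (\<lambda>w. mut_matrix_seq w B = B)"
  by (simp add: G_group_def word_group_def)

lemma H_group_eq: "H_group s = word_group (\<lambda>w. mut_seq w s = s)"
  by (simp add: H_group_def word_group_def)

lemma group_G_group: "group (G_group B)"
proof -
  have "mut_matrix_seq (rev w) B = B" if "mut_matrix_seq w B = B" for w
    using mut_matrix_seq_rev[of w B] that by simp
  then show ?thesis unfolding G_group_eq by (intro group_word_group) simp_all
qed

lemma group_H_group:
  assumes "labeled_seed s"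
  shows "group (H_group s)"
proof -
  have "mut_seq (rev w) s = s" if "mut_seq w s = s" for w
    using mut_seq_rev[OF assms, of w] that by simp
  then show ?thesis unfolding H_group_eq by (intro group_word_group) simp_all
qed

text \<open>
  Mutations are involutions on labeled seeds, so deleting or inserting a square has no effect.
\<close>

lemma mu_eq_imp_mut_seq_eq:
  assumes "labeled_seed s" "mu v = mu w"
  shows "mut_seq v s = mut_seq w s"
proof -
  have "mut_seq (rev (rev v)) s = mut_seq (rev b) s" if "(rev v, b) \<in> word_equiv" for b
    using that
  proof (induction rule: word_equiv_induct)
    case (insert u v' i)
    then show ?case by (simp add: mut_involution labeled_seed_mut_seq[OF assms(1)])
  next
    case (delete u v' i)
    then show ?case by (simp add: mut_involution labeled_seed_mut_seq[OF assms(1)])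
  qed simp
  then show ?thesis using assms(2) unfolding mu_eq_iff by fastforce
qed


section \<open>The groups of cluster automorphisms\<close>

context initial_seed
begin

lemma map_seed_compose:
  assumes "t \<in> seeds s"
  shows "map_seed (compose \<A> f g) t = map_seed f (map_seed g t)"
  using cluster_variable_in_ring[OF assms] by (simp add: map_seed_def compose_def comp_def)

lemma map_seed_id: "t \<in> seeds s \<Longrightarrow> map_seed (\<lambda>a\<in>\<A>. a) t = t"
  using cluster_variable_in_ring[of t s] by (simp add: map_seed_def comp_def)

lemma id_alg_auts: "(\<lambda>a\<in>\<A>. a) \<in> alg_auts s"
  using id_Bij[of \<A>] by (auto simp: alg_auts_iff Bij_def cluster_ring_closed)

lemma compose_alg_auts:
  assumes f: "f \<in> alg_auts s" and g: "g \<in> alg_auts s"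
  shows "compose \<A> f g \<in> alg_auts s"
  using compose_Bij[OF alg_autsD(1)[OF f] alg_autsD(1)[OF g]]
  by (auto simp: alg_auts_iff Bij_def compose_def cluster_ring_closed alg_autsD[OF f] alg_autsD[OF g])

lemma inverse_alg_auts:
  assumes f: "f \<in> alg_auts s"
  shows "restrict (inv_into \<A> f) \<A> \<in> alg_auts s"
    and "t \<in> seeds s \<Longrightarrow> map_seed (restrict (inv_into \<A> f) \<A>) (map_seed f t) = t"
proof -
  define g where "g = restrict (inv_into \<A> f) \<A>"
  have g: "g \<in> Bij \<A>"
    unfolding g_def by (rule restrict_inv_into_Bij[OF alg_autsD(1)[OF f]])
  have gf: "g (f a) = a" if "a \<in> \<A>" for a
    using that alg_autsD(3,5)[OF f] by (simp add: g_def bij_betw_inv_into_left)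
  have fg: "f (g a) = a" "g a \<in> \<A>" if "a \<in> \<A>" for a
    using that alg_autsD(3)[OF f] Bij_inv_into_mem[OF alg_autsD(1)[OF f]]
    by (simp_all add: g_def bij_betw_inv_into_right)
  have "g (a + b) = g a + g b \<and> g (a * b) = g a * g b" if "a \<in> \<A>" "b \<in> \<A>" for a b
  proof -
    have "g (f (g a + g b)) = g a + g b" "g (f (g a * g b)) = g a * g b"
      using fg(2) that by (intro gf cluster_ring_closed; simp)+
    moreover have "f (g a + g b) = a + b" "f (g a * g b) = a * b"
      using fg that by (simp_all only: alg_autsD(6,7)[OF f])
    ultimately show ?thesis by simp
  qed
  moreover have "g 1 = 1" using gf[of 1] alg_autsD(4)[OF f] cluster_ring_closed(1)[of s] by simp
  ultimately show "restrict (inv_into \<A> f) \<A> \<in> alg_auts s"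
    using g unfolding alg_auts_iff Bij_def g_def by blast
  show "map_seed (restrict (inv_into \<A> f) \<A>) (map_seed f t) = t" if "t \<in> seeds s"
    using gf cluster_variable_in_ring[OF that] unfolding g_def [symmetric]
    by (simp add: map_seed_def comp_def)
qed

lemma BijGroup_simps:
  "f \<in> alg_auts s \<Longrightarrow> g \<in> alg_auts s \<Longrightarrow> f \<otimes>\<^bsub>BijGroup \<A>\<^esub> g = compose \<A> f g"
  "\<one>\<^bsub>BijGroup \<A>\<^esub> = (\<lambda>a\<in>\<A>. a)"
  by (auto simp: BijGroup_def alg_autsD(1))

lemma subgroup_alg_auts:
  assumes "H \<subseteq> alg_auts s" "(\<lambda>a\<in>\<A>. a) \<in> H"
    and "\<And>f g. f \<in> H \<Longrightarrow> g \<in> H \<Longrightarrow> compose \<A> f g \<in> H"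
    and "\<And>f. f \<in> H \<Longrightarrow> restrict (inv_into \<A> f) \<A> \<in> H"
  shows "subgroup H (BijGroup \<A>)"
proof (rule subgroup.intro)
  have H: "f \<in> Bij \<A>" "f \<in> alg_auts s" if "f \<in> H" for f
    using alg_autsD(1)[of f] assms(1) that by blast+
  then show "H \<subseteq> carrier (BijGroup \<A>)" by (auto simp: BijGroup_def)
  show "f \<otimes>\<^bsub>BijGroup \<A>\<^esub> g \<in> H" if "f \<in> H" "g \<in> H" for f g
    using that H assms(3) by (simp add: BijGroup_simps)
  show "\<one>\<^bsub>BijGroup \<A>\<^esub> \<in> H" using assms(2) by (simp add: BijGroup_simps)
  show "inv\<^bsub>BijGroup \<A>\<^esub> f \<in> H" if "f \<in> H" for f
    using that H(1) assms(4) by (simp add: inv_BijGroup)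
qed

lemma group_Aut_plus: "group (Aut_plus s)"
proof -
  have "subgroup {f \<in> alg_auts s. map_seed f s \<in> seeds s} (BijGroup \<A>)"
  proof (rule subgroup_alg_auts, unfold mem_Collect_eq)
    show "{f \<in> alg_auts s. map_seed f s \<in> seeds s} \<subseteq> alg_auts s" by blast
    show "(\<lambda>a\<in>\<A>. a) \<in> alg_auts s \<and> map_seed (\<lambda>a\<in>\<A>. a) s \<in> seeds s"
      using id_alg_auts map_seed_id[OF seed_in_seeds] seed_in_seeds[of s] by simp
  next
    fix f g assume f: "f \<in> alg_auts s \<and> map_seed f s \<in> seeds s"
      and g: "g \<in> alg_auts s \<and> map_seed g s \<in> seeds s"
    then have "map_seed f (map_seed g s) \<in> seeds s" using map_seed_seeds[OF _ seed_in_seeds] by blast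
    then show "compose \<A> f g \<in> alg_auts s \<and> map_seed (compose \<A> f g) s \<in> seeds s"
      using f g compose_alg_auts unfolding map_seed_compose[OF seed_in_seeds] by blast
  next
    fix f assume f: "f \<in> alg_auts s \<and> map_seed f s \<in> seeds s"
    let ?g = "restrict (inv_into \<A> f) \<A>"
    note g = inverse_alg_auts[OF conjunct1[OF f]]
    have "map_seed ?g s \<in> seeds s"
      using map_seed_seeds[OF g(1) conjunct2[OF f] _ seed_in_seeds] g(2)[OF seed_in_seeds] seed_in_seeds[of s]
      by simp
    then show "?g \<in> alg_auts s \<and> map_seed ?g s \<in> seeds s" using g(1) by blast
  qed
  then show ?thesis unfolding Aut_plus_def direct_cluster_aut_iff
    by (rule subgroup.subgroup_is_group) (rule group_BijGroup)
qed

lemma group_SAut_plus: "group (SAut_plus s)"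
proof -
  have "subgroup {f \<in> alg_auts s. \<exists>w. map_seed f s = mut_seq w s} (BijGroup \<A>)"
  proof (rule subgroup_alg_auts, unfold mem_Collect_eq)
    show "{f \<in> alg_auts s. \<exists>w. map_seed f s = mut_seq w s} \<subseteq> alg_auts s" by blast
    show "(\<lambda>a\<in>\<A>. a) \<in> alg_auts s \<and> (\<exists>w. map_seed (\<lambda>a\<in>\<A>. a) s = mut_seq w s)"
      using id_alg_auts map_seed_id[OF seed_in_seeds] mut_seq_simps(1)[of s] by metis
  next
    fix f g assume f: "f \<in> alg_auts s \<and> (\<exists>w. map_seed f s = mut_seq w s)"
      and g: "g \<in> alg_auts s \<and> (\<exists>w. map_seed g s = mut_seq w s)"
    then obtain v w where v: "map_seed f s = mut_seq v s" and w: "map_seed g s = mut_seq w s" by blast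
    have "map_seed f (map_seed g s) = mut_seq (v @ w) s"
      using map_seed_aut_mut_seq[OF conjunct1[OF f] seed_in_seeds] by (simp add: v w)
    then show "compose \<A> f g \<in> alg_auts s \<and> (\<exists>w. map_seed (compose \<A> f g) s = mut_seq w s)"
      using f g compose_alg_auts map_seed_compose[OF seed_in_seeds] by metis
  next
    fix f assume f: "f \<in> alg_auts s \<and> (\<exists>w. map_seed f s = mut_seq w s)"
    then obtain w where w: "map_seed f s = mut_seq w s" by blast
    let ?g = "restrict (inv_into \<A> f) \<A>"
    note g = inverse_alg_auts[OF conjunct1[OF f]]
    have "mut_seq (rev w) (map_seed f s) = s" using w mut_seq_rev[OF seed] by simp
    moreover have "mut_seq (rev w) (map_seed f s) = map_seed f (mut_seq (rev w) s)"
      using map_seed_aut_mut_seq[OF conjunct1[OF f] seed_in_seeds] by simp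
    ultimately have "map_seed ?g s = mut_seq (rev w) s"
      using g(2)[OF mut_seq_in_seeds[of "rev w"]] by simp
    then show "?g \<in> alg_auts s \<and> (\<exists>w. map_seed ?g s = mut_seq w s)" using g(1) by blast
  qed
  then show ?thesis unfolding SAut_plus_def strict_direct_cluster_aut_iff
    by (rule subgroup.subgroup_is_group) (rule group_BijGroup)
qed

lemma Aut_plus_simps:
  "carrier (Aut_plus s) = {f \<in> alg_auts s. map_seed f s \<in> seeds s}"
  "\<one>\<^bsub>Aut_plus s\<^esub> = (\<lambda>a\<in>\<A>. a)"
  "f \<in> alg_auts s \<Longrightarrow> g \<in> alg_auts s \<Longrightarrow> f \<otimes>\<^bsub>Aut_plus s\<^esub> g = compose \<A> f g"
  by (auto simp: Aut_plus_def direct_cluster_aut_iff BijGroup_simps)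

lemma SAut_plus_simps:
  "carrier (SAut_plus s) = {f \<in> alg_auts s. \<exists>w. map_seed f s = mut_seq w s}"
  "\<one>\<^bsub>SAut_plus s\<^esub> = (\<lambda>a\<in>\<A>. a)"
  "f \<in> alg_auts s \<Longrightarrow> g \<in> alg_auts s \<Longrightarrow> f \<otimes>\<^bsub>SAut_plus s\<^esub> g = compose \<A> f g"
  by (auto simp: SAut_plus_def strict_direct_cluster_aut_iff BijGroup_simps)


section \<open>The first exact sequence\<close>

definition aut_to :: "('n, 'f) lseed \<Rightarrow> 'f \<Rightarrow> 'f" where
  "aut_to t = (THE f. f \<in> alg_auts s \<and> map_seed f s = t)"

lemma aut_to:
  assumes "t \<in> seeds s" "snd t = snd s"
  shows "aut_to t \<in> alg_auts s" "map_seed (aut_to t) s = t"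
proof -
  have "\<exists>!f. f \<in> alg_auts s \<and> map_seed f s = t"
    using alg_aut_exists[OF assms] alg_auts_eqI by blast
  from theI'[OF this] show "aut_to t \<in> alg_auts s" "map_seed (aut_to t) s = t"
    unfolding aut_to_def by blast+
qed

lemma aut_to_eqI: "f \<in> alg_auts s \<Longrightarrow> map_seed f s = t \<Longrightarrow> aut_to t = f"
  unfolding aut_to_def using alg_auts_eqI by blast

text \<open>
  The map \<open>\<phi>\<close> of the first sequence. The representing word is arbitrary because equivalent words act in
  the same way on the initial seed.
\<close>

definition period_aut :: "'n list set \<Rightarrow> 'f \<Rightarrow> 'f" where
  "period_aut U = aut_to (mut_seq (SOME w. mu w = U) s)"

lemma period_aut_mu: "period_aut (mu w) = aut_to (mut_seq w s)"
proof -
  have "mu (SOME v. mu v = mu w) = mu w" by (rule someI) simp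
  then have "mut_seq (SOME v. mu v = mu w) s = mut_seq w s"
    by (rule mu_eq_imp_mut_seq_eq[OF seed])
  then show ?thesis unfolding period_aut_def by simp
qed

lemma period_aut:
  assumes "mut_matrix_seq w (snd s) = snd s"
  shows "period_aut (mu w) \<in> alg_auts s" "map_seed (period_aut (mu w)) s = mut_seq w s"
  using aut_to[OF mut_seq_in_seeds[of w s]] assms by (simp_all add: period_aut_mu)

text \<open>
  For periods \<open>v\<close> and \<open>w\<close> of the matrix, with automorphisms \<open>f\<close> and \<open>g\<close>, one has
  \<open>f (g s) = f (\<mu>\<^sub>w s) = \<mu>\<^sub>w (f s) = \<mu>\<^sub>w (\<mu>\<^sub>v s)\<close>: the automorphism of \<open>v\<close> followed by \<open>w\<close> is \<open>f \<circ> g\<close>. This is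
  why the opposite group is the source.
\<close>

theorem short_exact_periods:
  "short_exact (H_group s) (G_group (snd s)) (SAut_plus s) (\<lambda>h. h) period_aut"
  unfolding short_exact_def
proof (intro conjI)
  let ?G = "G_group (snd s)" and ?H = "H_group s"
  note G = word_group_simps[of "\<lambda>w. mut_matrix_seq w (snd s) = snd s", folded G_group_eq]
  note H = word_group_simps[of "\<lambda>w. mut_seq w s = s", folded H_group_eq]
  have period: "mut_matrix_seq w (snd s) = snd s" if "mut_seq w s = s" for w
    using arg_cong[OF that, of snd] by simp
  show "group_hom ?H ?G (\<lambda>h. h)"
  proof (intro group_hom.intro group_hom_axioms.intro homI group_H_group[OF seed] group_G_group)
    show "h \<in> carrier ?G" if "h \<in> carrier ?H" for h
      using that period by (auto simp: G(1) H(1))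
    show "h \<otimes>\<^bsub>?H\<^esub> h' = h \<otimes>\<^bsub>?G\<^esub> h'" if "h \<in> carrier ?H" "h' \<in> carrier ?H" for h h'
      using that by (auto simp: H G(3))
  qed
  show "kernel ?H ?G (\<lambda>h. h) = {\<one>\<^bsub>?H\<^esub>}"
    using group.is_monoid[OF group_H_group[OF seed]] by (auto simp: kernel_def G(2) H(2) dest: monoid.one_closed)
  show "group_hom ?G (SAut_plus s) period_aut"
  proof (intro group_hom.intro group_hom_axioms.intro homI group_SAut_plus group_G_group)
    show "period_aut U \<in> carrier (SAut_plus s)" if U: "U \<in> carrier ?G" for U
    proof -
      obtain w where "U = mu w" "mut_matrix_seq w (snd s) = snd s" using U by (auto simp: G(1))
      then show ?thesis using period_aut[of w] by (auto simp: SAut_plus_simps(1))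
    qed
    show "period_aut (U \<otimes>\<^bsub>?G\<^esub> V) = period_aut U \<otimes>\<^bsub>SAut_plus s\<^esub> period_aut V"
      if U: "U \<in> carrier ?G" and V: "V \<in> carrier ?G" for U V
    proof -
      obtain v w where v: "U = mu v" "mut_matrix_seq v (snd s) = snd s"
        and w: "V = mu w" "mut_matrix_seq w (snd s) = snd s"
        using U V unfolding G(1) by blast
      have "map_seed (compose \<A> (period_aut U) (period_aut V)) s = mut_seq (v @ w) s"
        using map_seed_aut_mut_seq[OF period_aut(1)[OF v(2)] seed_in_seeds]
        by (simp add: map_seed_compose[OF seed_in_seeds] v(1) w(1) period_aut(2) v(2) w(2))
      then have "period_aut (mu (v @ w)) = compose \<A> (period_aut U) (period_aut V)"
        unfolding period_aut_mu
        by (intro aut_to_eqI) (use v w period_aut(1) compose_alg_auts in auto)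
      then show ?thesis
        using period_aut(1) v w by (simp add: G(3) SAut_plus_simps(3))
    qed
  qed
  show "kernel ?G (SAut_plus s) period_aut = (\<lambda>h. h) ` carrier ?H"
  proof -
    have "period_aut (mu w) = (\<lambda>a\<in>\<A>. a) \<longleftrightarrow> mut_seq w s = s"
      if "mut_matrix_seq w (snd s) = snd s" for w
      using period_aut[OF that] map_seed_id[OF seed_in_seeds] alg_auts_eqI[OF _ id_alg_auts] by metis
    then show ?thesis using period unfolding kernel_def G(1) H(1) SAut_plus_simps(2) by fastforce
  qed
  show "period_aut ` carrier ?G = carrier (SAut_plus s)"
  proof (intro equalityI subsetI)
    fix f assume "f \<in> period_aut ` carrier ?G"
    then show "f \<in> carrier (SAut_plus s)"
      using period_aut unfolding G(1) SAut_plus_simps(1) by fastforce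
  next
    fix f assume "f \<in> carrier (SAut_plus s)"
    then obtain w where f: "f \<in> alg_auts s" "map_seed f s = mut_seq w s"
      by (auto simp: SAut_plus_simps(1))
    have "mut_matrix_seq w (snd s) = snd s"
      unfolding snd_mut_seq [symmetric] f(2) [symmetric] by simp
    moreover have "period_aut (mu w) = f" unfolding period_aut_mu using f by (rule aut_to_eqI)
    ultimately show "f \<in> period_aut ` carrier ?G" unfolding G(1) by blast
  qed
qed


section \<open>The second exact sequence\<close>

lemma L_setI: "bij \<sigma> \<Longrightarrow> mut_matrix_seq w B = perm_matrix \<sigma> B \<Longrightarrow> \<sigma> \<in> L_set B"
  unfolding L_set_def by blast

lemma perm_matrix_comp: "perm_matrix \<sigma> (perm_matrix \<tau> B) = perm_matrix (\<tau> \<circ> \<sigma>) B"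
  by (simp add: perm_matrix_def)

lemma perm_matrix_id [simp]: "perm_matrix id B = B"
  by (simp add: perm_matrix_def)

lemma carrier_BijGroup_UNIV: "carrier (BijGroup UNIV) = {\<sigma>. bij \<sigma>}"
  by (simp add: BijGroup_def Bij_def)

lemma BijGroup_UNIV_simps:
  "bij \<sigma> \<Longrightarrow> bij \<tau> \<Longrightarrow> \<sigma> \<otimes>\<^bsub>BijGroup UNIV\<^esub> \<tau> = \<sigma> \<circ> \<tau>" "\<one>\<^bsub>BijGroup UNIV\<^esub> = id"
  "bij \<sigma> \<Longrightarrow> inv\<^bsub>BijGroup UNIV\<^esub> \<sigma> = pinv \<sigma>"
proof -
  show "inv\<^bsub>BijGroup UNIV\<^esub> \<sigma> = pinv \<sigma>" if "bij \<sigma>"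
    using that by (simp add: inv_BijGroup Bij_def restrict_def)
qed (auto simp: BijGroup_def Bij_def compose_def fun_eq_iff)

lemma bij_pinv: "bij \<sigma> \<Longrightarrow> bij (pinv \<sigma>)" by (rule bij_imp_bij_inv)

lemma subgroup_L_set: "subgroup (L_set B) (BijGroup UNIV)" for B :: "'n \<Rightarrow> 'n \<Rightarrow> int"
proof (rule subgroup.intro)
  show "L_set B \<subseteq> carrier (BijGroup UNIV)" by (auto simp: L_set_def carrier_BijGroup_UNIV)
  show "\<one>\<^bsub>BijGroup UNIV\<^esub> \<in> L_set B"
    using L_setI[of id "[]" B] by (simp add: BijGroup_UNIV_simps(2))
next
  fix \<sigma> \<tau> assume "\<sigma> \<in> L_set B" "\<tau> \<in> L_set B"
  then obtain v w where \<sigma>: "bij \<sigma>" "mut_matrix_seq v B = perm_matrix \<sigma> B"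
    and \<tau>: "bij \<tau>" "mut_matrix_seq w B = perm_matrix \<tau> B" unfolding L_set_def by blast
  have "perm_matrix (\<sigma> \<circ> \<tau>) B = perm_matrix \<tau> (mut_matrix_seq v B)"
    by (simp add: \<sigma>(2) perm_matrix_comp)
  also have "\<dots> = perm_matrix \<tau> (mut_matrix_seq (map \<tau> (map (pinv \<tau>) v)) B)" using \<tau>(1) by simp
  also have "\<dots> = mut_matrix_seq (map (pinv \<tau>) v) (perm_matrix \<tau> B)"
    using \<tau>(1) by (rule mut_matrix_seq_perm_matrix[symmetric])
  also have "\<dots> = mut_matrix_seq (w @ map (pinv \<tau>) v) B" by (simp add: \<tau>(2))
  finally have "\<sigma> \<circ> \<tau> \<in> L_set B"
    using \<sigma>(1) \<tau>(1) by (intro L_setI[of _ "w @ map (pinv \<tau>) v"]) (simp_all add: bij_comp)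
  then show "\<sigma> \<otimes>\<^bsub>BijGroup UNIV\<^esub> \<tau> \<in> L_set B" using \<sigma>(1) \<tau>(1) by (simp add: BijGroup_UNIV_simps)
next
  fix \<sigma> assume "\<sigma> \<in> L_set B"
  then obtain w where \<sigma>: "bij \<sigma>" "mut_matrix_seq w B = perm_matrix \<sigma> B" unfolding L_set_def by blast
  have "mut_matrix_seq (map \<sigma> w) (perm_matrix (pinv \<sigma>) B) =
      perm_matrix (pinv \<sigma>) (mut_matrix_seq (map (pinv \<sigma>) (map \<sigma> w)) B)"
    by (rule mut_matrix_seq_perm_matrix[OF bij_pinv[OF \<sigma>(1)]])
  also have "\<dots> = B" using \<sigma> by (simp add: perm_matrix_comp)
  finally have "mut_matrix_seq (rev (map \<sigma> w)) B = perm_matrix (pinv \<sigma>) B"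
    using mut_matrix_seq_rev[of "map \<sigma> w" "perm_matrix (pinv \<sigma>) B"] by simp
  then have "pinv \<sigma> \<in> L_set B" by (rule L_setI[OF bij_pinv[OF \<sigma>(1)]])
  then show "inv\<^bsub>BijGroup UNIV\<^esub> \<sigma> \<in> L_set B" using \<sigma>(1) by (simp add: BijGroup_UNIV_simps)
qed

lemma group_L_group: "group (L_group B)" for B :: "'n \<Rightarrow> 'n \<Rightarrow> int"
  unfolding L_group_def by (rule subgroup.subgroup_is_group[OF subgroup_L_set group_BijGroup])

lemma L_set_bij: "\<sigma> \<in> L_set B \<Longrightarrow> bij \<sigma>" by (simp add: L_set_def)

lemma L_group_simps:
  fixes B :: "'n \<Rightarrow> 'n \<Rightarrow> int"
  shows "carrier (L_group B) = L_set B" "\<one>\<^bsub>L_group B\<^esub> = id"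
    "\<sigma> \<in> L_set B \<Longrightarrow> \<tau> \<in> L_set B \<Longrightarrow> \<sigma> \<otimes>\<^bsub>L_group B\<^esub> \<tau> = \<sigma> \<circ> \<tau>"
    "\<sigma> \<in> L_set B \<Longrightarrow> inv\<^bsub>L_group B\<^esub> \<sigma> = pinv \<sigma>"
proof -
  show inv: "inv\<^bsub>L_group B\<^esub> \<sigma> = pinv \<sigma>" if "\<sigma> \<in> L_set B"
    using group.m_inv_consistent[OF group_BijGroup subgroup_L_set that]
    by (simp add: L_group_def BijGroup_UNIV_simps(3)[OF L_set_bij[OF that]])
qed (simp_all add: L_group_def BijGroup_UNIV_simps L_set_bij)

lemma L_set_comp: "\<sigma> \<in> L_set B \<Longrightarrow> \<tau> \<in> L_set B \<Longrightarrow> \<sigma> \<circ> \<tau> \<in> L_set B" for B :: "'n \<Rightarrow> 'n \<Rightarrow> int"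
  using group.is_monoid[OF group_L_group[of B]] monoid.m_closed[of "L_group B" \<sigma> \<tau>]
  by (simp add: L_group_simps)

lemma L_set_inv: "\<sigma> \<in> L_set B \<Longrightarrow> pinv \<sigma> \<in> L_set B" for B :: "'n \<Rightarrow> 'n \<Rightarrow> int"
  using group.inv_closed[OF group_L_group[of B], of \<sigma>] by (simp add: L_group_simps)

lemma P_setI: "bij \<sigma> \<Longrightarrow> mut_seq w s = perm_seed \<sigma> s \<Longrightarrow> \<sigma> \<in> P_set s"
  unfolding P_set_def by blast

lemma P_set_subset: "P_set s \<subseteq> L_set (snd s)"
proof
  fix \<tau> assume "\<tau> \<in> P_set s"
  then obtain w where w: "bij \<tau>" "mut_seq w s = perm_seed \<tau> s" unfolding P_set_def by blast
  have "mut_matrix_seq w (snd s) = perm_matrix \<tau> (snd s)"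
    unfolding snd_mut_seq [symmetric] w(2) by (simp add: perm_seed_def)
  then show "\<tau> \<in> L_set (snd s)" by (rule L_setI[OF w(1)])
qed

lemma P_set_comp:
  assumes "\<sigma> \<in> P_set s" "\<tau> \<in> P_set s"
  shows "\<sigma> \<circ> \<tau> \<in> P_set s"
proof -
  obtain v w where \<sigma>: "bij \<sigma>" "mut_seq v s = perm_seed \<sigma> s"
    and \<tau>: "bij \<tau>" "mut_seq w s = perm_seed \<tau> s" using assms unfolding P_set_def by blast
  have "perm_seed (\<sigma> \<circ> \<tau>) s = perm_seed \<tau> (mut_seq v s)" by (simp add: \<sigma>(2))
  also have "\<dots> = mut_seq (w @ map (pinv \<tau>) v) s"
    by (simp add: \<tau>(2) perm_seed_mut_seq[OF \<tau>(1)])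
  finally show ?thesis
    using \<sigma>(1) \<tau>(1) by (intro P_setI[of _ "w @ map (pinv \<tau>) v"]) (simp_all add: bij_comp)
qed

lemma P_set_inv:
  assumes "\<sigma> \<in> P_set s"
  shows "pinv \<sigma> \<in> P_set s"
proof -
  obtain w where \<sigma>: "bij \<sigma>" "mut_seq w s = perm_seed \<sigma> s" using assms unfolding P_set_def by blast
  have "mut_seq (map \<sigma> w) (perm_seed (pinv \<sigma>) s) = perm_seed (pinv \<sigma>) (mut_seq w s)"
    using \<sigma>(1) by (simp add: mut_seq_perm_seed bij_pinv)
  also have "\<dots> = s" using \<sigma> by simp
  finally have "mut_seq (rev (map \<sigma> w)) s = perm_seed (pinv \<sigma>) s"
    using mut_seq_rev[OF labeled_seed_perm_seed[OF seed bij_pinv[OF \<sigma>(1)]], of "map \<sigma> w"] by simp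
  then show ?thesis by (rule P_setI[OF bij_pinv[OF \<sigma>(1)]])
qed

text \<open>
  Normality holds because membership of \<open>\<tau>\<close> in \<open>P\<^sub>n\<close> only depends on the matrix
  (\<open>periodicity_transfer\<close>). It may therefore be tested on the seed \<open>t\<^bsup>\<sigma>\<inverse>\<^esup>\<close>, where
  \<open>t = \<mu>\<^sub>w s\<close> has matrix \<open>B\<^sup>\<sigma>\<close>; for \<open>t\<close> itself, and hence for \<open>s\<close>, this is the conjugated permutation.
\<close>

lemma P_set_conj:
  assumes \<sigma>: "\<sigma> \<in> L_set (snd s)" and \<tau>: "\<tau> \<in> P_set s"
  shows "pinv \<sigma> \<circ> \<tau> \<circ> \<sigma> \<in> P_set s"
proof -
  have \<sigma>': "bij \<sigma>" using \<sigma> by (rule L_set_bij)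
  obtain w where w: "mut_matrix_seq w (snd s) = perm_matrix \<sigma> (snd s)"
    using \<sigma> unfolding L_set_def by blast
  obtain v where v: "bij \<tau>" "mut_seq v s = perm_seed \<tau> s" using \<tau> unfolding P_set_def by blast
  define t where "t = mut_seq w s"
  have t: "labeled_seed t" unfolding t_def by (rule labeled_seed_mut_seq[OF seed])
  have "snd s = snd (perm_seed (pinv \<sigma>) t)"
    using w \<sigma>' by (simp add: t_def perm_seed_def perm_matrix_comp)
  then have "mut_seq v (perm_seed (pinv \<sigma>) t) = perm_seed \<tau> (perm_seed (pinv \<sigma>) t)"
    using periodicity_transfer[OF seed labeled_seed_perm_seed[OF t bij_pinv[OF \<sigma>']] _ v(2)] by simp
  then have "perm_seed \<sigma> (perm_seed (pinv \<sigma>) (mut_seq (map (pinv \<sigma>) v) t)) =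
      perm_seed \<sigma> (perm_seed \<tau> (perm_seed (pinv \<sigma>) t))"
    by (simp only: mut_seq_perm_seed[OF bij_pinv[OF \<sigma>']])
  then have "mut_seq (map (pinv \<sigma>) v) t = perm_seed (pinv \<sigma> \<circ> \<tau> \<circ> \<sigma>) t"
    using \<sigma>' by (simp add: comp_assoc)
  moreover define \<rho> where "\<rho> = pinv \<sigma> \<circ> \<tau> \<circ> \<sigma>"
  ultimately have "mut_seq (w @ map (pinv \<sigma>) v) s = perm_seed \<rho> (mut_seq w s)"
    by (simp add: t_def)
  moreover have \<rho>: "bij \<rho>" using \<sigma>' v(1) by (auto simp: \<rho>_def intro!: bij_comp bij_pinv)
  ultimately have "mut_seq (w @ map (pinv \<sigma>) v) s = mut_seq (map (pinv \<rho>) w) (perm_seed \<rho> s)"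
    by (simp add: perm_seed_mut_seq)
  then have "mut_seq (w @ map (pinv \<sigma>) v @ rev (map (pinv \<rho>) w)) s = perm_seed \<rho> s"
    using mut_seq_rev[OF labeled_seed_perm_seed[OF seed \<rho>], of "map (pinv \<rho>) w"] by simp
  then have "\<rho> \<in> P_set s" by (rule P_setI[OF \<rho>])
  then show ?thesis by (simp only: \<rho>_def)
qed

lemma normal_P_set: "P_set s \<lhd> L_group (snd s)"
proof (rule group.normal_invI[OF group_L_group])
  have sub: "\<tau> \<in> L_set (snd s)" if "\<tau> \<in> P_set s" for \<tau> using that P_set_subset by blast
  show "subgroup (P_set s) (L_group (snd s))"
  proof (rule subgroup.intro)
    show "P_set s \<subseteq> carrier (L_group (snd s))" using P_set_subset by (simp add: L_group_simps)
    show "\<one>\<^bsub>L_group (snd s)\<^esub> \<in> P_set s" using P_setI[of id "[]"] by (simp add: L_group_simps)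
    show "\<sigma> \<otimes>\<^bsub>L_group (snd s)\<^esub> \<tau> \<in> P_set s" if "\<sigma> \<in> P_set s" "\<tau> \<in> P_set s" for \<sigma> \<tau>
      using that sub P_set_comp by (simp add: L_group_simps)
    show "inv\<^bsub>L_group (snd s)\<^esub> \<sigma> \<in> P_set s" if "\<sigma> \<in> P_set s" for \<sigma>
      using that sub P_set_inv by (simp add: L_group_simps)
  qed
  fix \<sigma> \<tau> assume \<sigma>: "\<sigma> \<in> carrier (L_group (snd s))" and \<tau>: "\<tau> \<in> P_set s"
  then have \<sigma>': "\<sigma> \<in> L_set (snd s)" "bij \<sigma>" using L_set_bij by (auto simp: L_group_simps)
  have "pinv (pinv \<sigma>) \<circ> \<tau> \<circ> pinv \<sigma> \<in> P_set s" by (rule P_set_conj[OF L_set_inv[OF \<sigma>'(1)] \<tau>])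
  then show "\<sigma> \<otimes>\<^bsub>L_group (snd s)\<^esub> \<tau> \<otimes>\<^bsub>L_group (snd s)\<^esub> inv\<^bsub>L_group (snd s)\<^esub> \<sigma> \<in> P_set s"
    using \<sigma>' sub[OF \<tau>] by (simp add: L_group_simps L_set_comp L_set_inv inv_inv_eq)
qed

text \<open>
  The map \<open>\<psi>\<close> of the second sequence. Taking all permutations at once avoids a choice; the set is a
  coset of \<open>P\<^sub>n\<close>.
\<close>

definition relabelings :: "('f \<Rightarrow> 'f) \<Rightarrow> ('n \<Rightarrow> 'n) set" where
  "relabelings f = {\<sigma>. bij \<sigma> \<and> (\<exists>w. map_seed f s = perm_seed \<sigma> (mut_seq w s))}"

lemma relabelings_subset:
  assumes "\<sigma> \<in> relabelings f"
  shows "\<sigma> \<in> L_set (snd s)"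
proof -
  obtain w where \<sigma>: "bij \<sigma>" "map_seed f s = perm_seed \<sigma> (mut_seq w s)"
    using assms unfolding relabelings_def by blast
  have "snd s = perm_matrix \<sigma> (mut_matrix_seq w (snd s))"
    using arg_cong[OF \<sigma>(2), of snd] by (simp add: perm_seed_def)
  then have "perm_matrix (pinv \<sigma>) (snd s) = perm_matrix (pinv \<sigma>) (perm_matrix \<sigma> (mut_matrix_seq w (snd s)))"
    by simp
  then have "mut_matrix_seq w (snd s) = perm_matrix (pinv \<sigma>) (snd s)"
    using \<sigma>(1) by (simp add: perm_matrix_comp)
  then have "pinv \<sigma> \<in> L_set (snd s)" by (rule L_setI[OF bij_pinv[OF \<sigma>(1)]])
  then show ?thesis using L_set_inv[of "pinv \<sigma>" "snd s"] \<sigma>(1) by (simp add: inv_inv_eq)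
qed

text \<open>
  Two ways to write the image of \<open>s\<close> as \<open>(\<mu>\<^sub>w s)\<^sup>\<sigma> = (\<mu>\<^sub>v s)\<^sup>\<rho>\<close> yield a mutation sequence from \<open>s\<close> to
  \<open>s\<^sup>\<tau>\<close> with \<open>\<tau> = \<rho> \<sigma>\<inverse>\<close>, and conversely.
\<close>

lemma relabelings_eq_coset:
  assumes "\<sigma> \<in> relabelings f"
  shows "relabelings f = P_set s #>\<^bsub>L_group (snd s)\<^esub> \<sigma>"
proof -
  obtain w where \<sigma>: "bij \<sigma>" "map_seed f s = perm_seed \<sigma> (mut_seq w s)"
    using assms unfolding relabelings_def by blast
  have coset: "P_set s #>\<^bsub>L_group (snd s)\<^esub> \<sigma> = {\<tau> \<circ> \<sigma> | \<tau>. \<tau> \<in> P_set s}"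
    using P_set_subset relabelings_subset[OF assms]
    by (auto simp: r_coset_def L_group_simps(3) subset_iff)
  show ?thesis unfolding coset
  proof (intro equalityI subsetI)
    fix \<rho> assume "\<rho> \<in> relabelings f"
    then obtain v where \<rho>: "bij \<rho>" "map_seed f s = perm_seed \<rho> (mut_seq v s)"
      unfolding relabelings_def by blast
    define \<tau> where "\<tau> = \<rho> \<circ> pinv \<sigma>"
    have \<tau>: "bij \<tau>" unfolding \<tau>_def using \<sigma>(1) \<rho>(1) by (intro bij_comp bij_pinv)
    have "perm_seed (pinv \<sigma>) (perm_seed \<rho> (mut_seq v s)) = perm_seed (pinv \<sigma>) (perm_seed \<sigma> (mut_seq w s))"
      using \<sigma>(2) \<rho>(2) by simp
    then have "perm_seed \<tau> (mut_seq v s) = mut_seq w s" using \<sigma>(1) by (simp add: \<tau>_def)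
    then have "mut_seq (map (pinv \<tau>) v) (perm_seed \<tau> s) = mut_seq w s"
      by (simp add: perm_seed_mut_seq[OF \<tau>])
    then have "mut_seq (rev (map (pinv \<tau>) v)) (mut_seq w s) = perm_seed \<tau> s"
      using mut_seq_rev[OF labeled_seed_perm_seed[OF seed \<tau>], of "map (pinv \<tau>) v"] by simp
    then have "\<tau> \<in> P_set s" using P_setI[OF \<tau>, of "w @ rev (map (pinv \<tau>) v)"] by simp
    moreover have "\<rho> = \<tau> \<circ> \<sigma>" using \<sigma>(1) by (simp add: \<tau>_def comp_assoc)
    ultimately show "\<rho> \<in> {\<tau> \<circ> \<sigma> | \<tau>. \<tau> \<in> P_set s}" by blast
  next
    fix \<rho> assume "\<rho> \<in> {\<tau> \<circ> \<sigma> | \<tau>. \<tau> \<in> P_set s}"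
    then obtain \<tau> u where \<rho>: "\<rho> = \<tau> \<circ> \<sigma>" and \<tau>: "bij \<tau>" "mut_seq u s = perm_seed \<tau> s"
      unfolding P_set_def by blast
    have "perm_seed \<tau> (mut_seq (map \<tau> (rev u @ w)) s) = mut_seq (rev u @ w) (perm_seed \<tau> s)"
      by (rule mut_seq_perm_seed[OF \<tau>(1), symmetric])
    also have "\<dots> = mut_seq w s" using mut_seq_rev[OF seed, of u] by (simp add: \<tau>(2)[symmetric])
    finally have "map_seed f s = perm_seed \<rho> (mut_seq (map \<tau> (rev u @ w)) s)"
      unfolding \<rho> \<sigma>(2) by (metis perm_seed_perm_seed)
    moreover have "bij \<rho>" unfolding \<rho> using \<sigma>(1) \<tau>(1) by (rule bij_comp)
    ultimately show "\<rho> \<in> relabelings f" unfolding relabelings_def by blast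
  qed
qed

lemma relabelings_nonempty:
  assumes "map_seed f s \<in> seeds s"
  obtains \<sigma> where "\<sigma> \<in> relabelings f"
  using assms unfolding seeds_iff relabelings_def by blast

lemma relabelings_comp:
  assumes f: "f \<in> alg_auts s" and "\<sigma> \<in> relabelings f" "\<tau> \<in> relabelings g"
  shows "\<sigma> \<circ> \<tau> \<in> relabelings (compose \<A> f g)"
proof -
  obtain v w where \<sigma>: "bij \<sigma>" "map_seed f s = perm_seed \<sigma> (mut_seq v s)"
    and \<tau>: "bij \<tau>" "map_seed g s = perm_seed \<tau> (mut_seq w s)"
    using assms(2,3) unfolding relabelings_def by blast
  have "map_seed (compose \<A> f g) s = perm_seed \<tau> (mut_seq w (map_seed f s))"
    by (simp only: map_seed_compose[OF seed_in_seeds] \<tau>(2) map_seed_perm_seed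
        map_seed_aut_mut_seq[OF f seed_in_seeds])
  also have "\<dots> = perm_seed (\<sigma> \<circ> \<tau>) (mut_seq (v @ map \<sigma> w) s)"
    by (simp add: \<sigma>(2) mut_seq_perm_seed[OF \<sigma>(1)])
  finally show ?thesis
    unfolding relabelings_def using bij_comp[OF \<tau>(1) \<sigma>(1)] by blast
qed

text \<open>
  An automorphism lies in the kernel if the identity is one of its relabelings, that is, if it maps
  the initial seed to a mutation of it. Every \<open>\<sigma>\<close> in \<open>L\<^sub>n\<close> occurs: as \<open>\<sigma>\<inverse>\<close> is in \<open>L\<^sub>n\<close>, there is a \<open>w\<close> such that
  \<open>\<mu>\<^sub>w (B) = B\<^bsup>\<sigma>\<inverse>\<^esup>\<close>, and \<open>(\<mu>\<^sub>w s)\<^sup>\<sigma>\<close> is a seed with matrix \<open>B\<close>.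
\<close>

theorem short_exact_relabelings:
  "short_exact (SAut_plus s) (Aut_plus s) (L_group (snd s) Mod P_set s) (\<lambda>f. f) relabelings"
  unfolding short_exact_def
proof (intro conjI)
  let ?S = "SAut_plus s" and ?A = "Aut_plus s" and ?L = "L_group (snd s)" and ?P = "P_set s"
  interpret P: normal ?P ?L by (rule normal_P_set)
  have strict: "map_seed f s \<in> seeds s" if "map_seed f s = mut_seq w s" for f w
    using mut_seq_in_seeds[of w s] that by simp
  show "group_hom ?S ?A (\<lambda>f. f)"
  proof (intro group_hom.intro group_hom_axioms.intro homI group_SAut_plus group_Aut_plus)
    show "f \<in> carrier ?A" if "f \<in> carrier ?S" for f
      using that strict by (auto simp: SAut_plus_simps(1) Aut_plus_simps(1))
    show "f \<otimes>\<^bsub>?S\<^esub> g = f \<otimes>\<^bsub>?A\<^esub> g" if "f \<in> carrier ?S" "g \<in> carrier ?S" for f g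
      using that by (simp add: SAut_plus_simps Aut_plus_simps(3))
  qed
  show "kernel ?S ?A (\<lambda>f. f) = {\<one>\<^bsub>?S\<^esub>}"
    using group.is_monoid[OF group_SAut_plus]
    by (auto simp: kernel_def SAut_plus_simps(2) Aut_plus_simps(2) dest: monoid.one_closed)
  have coset: "relabelings f \<in> carrier (?L Mod ?P)" if f: "f \<in> carrier ?A" for f
  proof -
    obtain \<sigma> where \<sigma>: "\<sigma> \<in> relabelings f"
      using f relabelings_nonempty[of f] unfolding Aut_plus_simps(1) by blast
    show ?thesis
      using relabelings_eq_coset[OF \<sigma>] relabelings_subset[OF \<sigma>]
      by (auto simp: carrier_FactGroup L_group_simps(1))
  qed
  show "group_hom ?A (?L Mod ?P) relabelings"
  proof (intro group_hom.intro group_hom_axioms.intro homI group_Aut_plus P.factorgroup_is_group coset)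
    fix f g assume fg: "f \<in> carrier ?A" "g \<in> carrier ?A"
    then have f: "f \<in> alg_auts s" and g: "g \<in> alg_auts s" by (auto simp: Aut_plus_simps(1))
    obtain \<sigma> \<tau> where \<sigma>: "\<sigma> \<in> relabelings f" and \<tau>: "\<tau> \<in> relabelings g"
      using fg relabelings_nonempty by (metis (no_types, lifting) Aut_plus_simps(1) mem_Collect_eq)
    note L = relabelings_subset[OF \<sigma>] relabelings_subset[OF \<tau>]
    have "relabelings f <#>\<^bsub>?L\<^esub> relabelings g = ?P #>\<^bsub>?L\<^esub> (\<sigma> \<circ> \<tau>)"
      using P.rcos_sum[of \<sigma> \<tau>] L
      by (simp add: relabelings_eq_coset[OF \<sigma>] relabelings_eq_coset[OF \<tau>] L_group_simps)
    also have "\<dots> = relabelings (compose \<A> f g)"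
      by (rule relabelings_eq_coset[OF relabelings_comp[OF f \<sigma> \<tau>], symmetric])
    finally show "relabelings (f \<otimes>\<^bsub>?A\<^esub> g) = relabelings f \<otimes>\<^bsub>?L Mod ?P\<^esub> relabelings g"
      using f g by (simp add: Aut_plus_simps(3))
  qed
  have strict_iff: "relabelings f = ?P \<longleftrightarrow> (\<exists>w. map_seed f s = mut_seq w s)" for f
  proof
    assume "relabelings f = ?P"
    moreover have "id \<in> ?P" using P_setI[of id "[]"] by simp
    ultimately have "id \<in> relabelings f" by simp
    then show "\<exists>w. map_seed f s = mut_seq w s" by (simp add: relabelings_def)
  next
    assume "\<exists>w. map_seed f s = mut_seq w s"
    then have "id \<in> relabelings f" by (simp add: relabelings_def)
    then have "relabelings f = ?P #>\<^bsub>?L\<^esub> id" by (rule relabelings_eq_coset)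
    also have "\<dots> = ?P"
      using P.coset_mult_one[OF P.subset] by (simp add: L_group_simps(2))
    finally show "relabelings f = ?P" .
  qed
  show "kernel ?A (?L Mod ?P) relabelings = (\<lambda>f. f) ` carrier ?S"
    using strict by (auto simp: kernel_def strict_iff SAut_plus_simps(1) Aut_plus_simps(1))
  show "relabelings ` carrier ?A = carrier (?L Mod ?P)"
  proof (intro equalityI subsetI)
    fix U assume "U \<in> carrier (?L Mod ?P)"
    then obtain \<sigma> where U: "U = ?P #>\<^bsub>?L\<^esub> \<sigma>" and \<sigma>: "\<sigma> \<in> L_set (snd s)"
      by (auto simp: carrier_FactGroup L_group_simps(1))
    then have bij: "bij \<sigma>" using L_set_bij by blast
    obtain w where w: "mut_matrix_seq w (snd s) = perm_matrix (pinv \<sigma>) (snd s)"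
      using L_set_inv[OF \<sigma>] unfolding L_set_def by blast
    let ?t = "perm_seed \<sigma> (mut_seq w s)"
    have t: "?t \<in> seeds s" using bij unfolding seeds_iff by blast
    moreover have "snd ?t = snd s" using w bij by (simp add: perm_seed_def perm_matrix_comp)
    ultimately obtain f where f: "f \<in> alg_auts s" "map_seed f s = ?t"
      using alg_aut_exists by blast
    then have "\<sigma> \<in> relabelings f" unfolding relabelings_def using bij by blast
    then have "relabelings f = U" unfolding U by (rule relabelings_eq_coset)
    then show "U \<in> relabelings ` carrier ?A" using f t by (auto simp: Aut_plus_simps(1))
  qed (use coset in auto)
qed

end


section \<open>The two exact sequences\<close>

theorem theorem1p1:
  fixes x :: "'n::finite \<Rightarrow> 'f::field_char_0" and B :: "'n \<Rightarrow> 'n \<Rightarrow> int"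
  assumes "labeled_seed (x, B)"
  shows "(\<exists>\<phi>. short_exact (H_group (x, B)) (G_group B) (SAut_plus (x, B)) (\<lambda>h. h) \<phi>) \<and>
         (\<exists>\<psi>. short_exact (SAut_plus (x, B)) (Aut_plus (x, B)) (L_group B Mod P_set (x, B)) (\<lambda>f. f) \<psi>)"
proof -
  interpret initial_seed "(x, B)" by (rule initial_seed.intro) (rule assms)
  show ?thesis
    using short_exact_periods short_exact_relabelings unfolding snd_conv by blast
qed

end
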